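(* Let $(b,c)$ be a connected and uniformly transient graph over the countably infinite set $X$. For each $\varphi\in C_0(\partial_hX)$ the problem $$\mathcal L f=0\ \text{ on }X,\qquad \hat f|_{\partial_hX}=\varphi$$ has a unique solution $f_\varphi\in\mathcal A$. Furthermore, the mapping $C_0(\partial_hX)\to\mathcal A$, $\varphi\mapsto f_\varphi$, is an isometry (with respect to the supremum norms).
   Context: $X$ is a countably infinite set, $C(X)$ the real-valued functions on $X$, $C_c(X)$ those with finite support, $\ell^\infty(X)$ the bounded ones, $\|f\|_\infty=\sup_X|f|$, and $C_0(X)$ is the closure of $C_c(X)$ with respect to $\|\cdot\|_\infty$. A graph $(b,c)$ over $X$ consists of a symmetric $b:X\times X\to[0,\infty)$ with zero diagonal and $\sum_{y}b(x,y)<\infty$ for all $x$, and an arbitrary $c:X\to[0,\infty)$. It is connected if for any two distinct $x,y\in X$ there are $x=x_0,\dots,x_n=y$ with $b(x_{i-1},x_i)>0$ for $i=1,\dots,n$. For $f\in C(X)$ put $\widetilde Q(f)=\frac12\sum_{x,y}b(x,y)|f(x)-f(y)|^2+\sum_x c(x)|f(x)|^2\in[0,\infty]$ and $\widetilde D=\{f\in C(X):\widetilde Q(f)<\infty\}$. For $o\in X$ put $\|f\|_o=(\widetilde Q(f)+|f(o)|^2)^{1/2}$; $\widetilde D_0$ is the closure of $C_c(X)$ in $\widetilde D$ with respect to $\|\cdot\|_o$ (independent of $o$ for connected graphs). A connected graph is uniformly transient if $\widetilde D_0\subseteq C_0(X)$. The formal Laplacian $\mathcal L$ acts on $\widetilde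 F=\{f\in C(X):\sum_y b(x,y)|f(y)|<\infty\ \forall x\in X\}$ by $\mathcal Lf(x)=\sum_y b(x,y)(f(x)-f(y))+c(x)f(x)$. The Royden compactification $R$ of $(b,c)$ is the unique (up to homeomorphism) compact Hausdorff space such that $X$ (discrete) is a dense open subset of $R$, each function in the algebra $\widetilde D\cap\ell^\infty(X)$ extends uniquely to a continuous function on $R$, and (the extensions of) $\widetilde D\cap\ell^\infty(X)$ separate the points of $R$. The Royden algebra $\mathcal A$ is the closure of $\widetilde D\cap\ell^\infty(X)$ in $\ell^\infty(X)$ with respect to $\|\cdot\|_\infty$; each $f\in\mathcal A$ has a unique continuous extension $\hat f$ to $R$. The Royden boundary is $\partial_RX=R\setminus X$, the harmonic boundary is $\partial_hX=\{x\in\partial_RX:\hat f(x)=0\text{ for all }f\in\widetilde D_0\cap\ell^\infty(X)\}$, and $C_0(\partial_hX)=\{\hat f|_{\partial_hX}:f\in\mathcal A\}$. *)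

theory Defs
  imports "HOL-Analysis.Analysis"
begin

text \<open>
  The vertex set \<open>X\<close> is the universe of the type \<open>'v\<close>; that it is countably infinite is a
  hypothesis of the theorem.
\<close>

definition weighted_graph :: "('v \<Rightarrow> 'v \<Rightarrow> real) \<Rightarrow> ('v \<Rightarrow> real) \<Rightarrow> bool" where
  "weighted_graph b c \<longleftrightarrow>
     (\<forall>x y. b x y \<ge> 0) \<and> (\<forall>x y. b x y = b y x) \<and> (\<forall>x. b x x = 0) \<and>
     (\<forall>x. (\<lambda>y. b x y) summable_on UNIV) \<and> (\<forall>x. c x \<ge> 0)"

definition graph_connected :: "('v \<Rightarrow> 'v \<Rightarrow> real) \<Rightarrow> bool" where
  "graph_connected b \<longleftrightarrow>
     (\<forall>x y. x \<noteq> y \<longrightarrow>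
        (\<exists>(n::nat) w. w 0 = x \<and> w n = y \<and> (\<forall>i\<in>{1..n}. b (w (i - 1)) (w i) > 0)))"

definition C_c :: "('v \<Rightarrow> real) set" where
  "C_c = {f. finite {x. f x \<noteq> 0}}"

definition ell_infinity :: "('v \<Rightarrow> real) set" where
  "ell_infinity = {f. bounded (range f)}"

text \<open>The supremum of the empty set of reals is unspecified in HOL, hence the case distinction.\<close>

definition sup_norm :: "'x set \<Rightarrow> ('x \<Rightarrow> real) \<Rightarrow> real" where
  "sup_norm S f = (if S = {} then 0 else (SUP x\<in>S. \<bar>f x\<bar>))"

text \<open>The closure of \<open>B\<close> in \<open>A\<close> with respect to the norm \<open>N\<close>.\<close>

definition norm_closure ::
  "(('v \<Rightarrow> real) \<Rightarrow> real) \<Rightarrow> ('v \<Rightarrow> real) set \<Rightarrow> ('v \<Rightarrow> real) set \<Rightarrow> ('v \<Rightarrow> real) set" where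
  "norm_closure N A B = {f \<in> A. \<forall>\<epsilon>>0. \<exists>g\<in>B. N (\<lambda>x. f x - g x) < \<epsilon>}"

definition C_0 :: "('v \<Rightarrow> real) set" where
  "C_0 = norm_closure (sup_norm UNIV) ell_infinity C_c"

definition Q_tilde :: "('v \<Rightarrow> 'v \<Rightarrow> real) \<Rightarrow> ('v \<Rightarrow> real) \<Rightarrow> ('v \<Rightarrow> real) \<Rightarrow> ennreal" where
  "Q_tilde b c f =
     (1 / 2) * (\<Sum>\<^sub>\<infinity>(x, y)\<in>UNIV. ennreal (b x y * \<bar>f x - f y\<bar>\<^sup>2))
     + (\<Sum>\<^sub>\<infinity>x\<in>UNIV. ennreal (c x * \<bar>f x\<bar>\<^sup>2))"

definition D_tilde :: "('v \<Rightarrow> 'v \<Rightarrow> real) \<Rightarrow> ('v \<Rightarrow> real) \<Rightarrow> ('v \<Rightarrow> real) set" where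
  "D_tilde b c = {f. Q_tilde b c f < \<infinity>}"

text \<open>
  Only meaningful on \<open>D_tilde b c\<close>, where no information is lost by \<^const>\<open>enn2real\<close>.
  The vertex \<open>v\<close> is the reference vertex of the norm.
\<close>

definition D_norm ::
  "('v \<Rightarrow> 'v \<Rightarrow> real) \<Rightarrow> ('v \<Rightarrow> real) \<Rightarrow> 'v \<Rightarrow> ('v \<Rightarrow> real) \<Rightarrow> real" where
  "D_norm b c v f = sqrt (enn2real (Q_tilde b c f) + \<bar>f v\<bar>\<^sup>2)"

text \<open>
  For connected graphs this does not depend on \<open>v\<close>; the reference vertex is carried along as a
  parameter by everything that refers to \<open>D_tilde0\<close>.
\<close>

definition D_tilde0 :: "('v \<Rightarrow> 'v \<Rightarrow> real) \<Rightarrow> ('v \<Rightarrow> real) \<Rightarrow> 'v \<Rightarrow> ('v \<Rightarrow> real) set" where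
  "D_tilde0 b c v = norm_closure (D_norm b c v) (D_tilde b c) C_c"

definition uniformly_transient ::
  "('v \<Rightarrow> 'v \<Rightarrow> real) \<Rightarrow> ('v \<Rightarrow> real) \<Rightarrow> 'v \<Rightarrow> bool" where
  "uniformly_transient b c v \<longleftrightarrow> D_tilde0 b c v \<subseteq> C_0"

definition F_tilde :: "('v \<Rightarrow> 'v \<Rightarrow> real) \<Rightarrow> ('v \<Rightarrow> real) set" where
  "F_tilde b = {f. \<forall>x. (\<lambda>y. b x y * \<bar>f y\<bar>) summable_on UNIV}"

definition laplacian ::
  "('v \<Rightarrow> 'v \<Rightarrow> real) \<Rightarrow> ('v \<Rightarrow> real) \<Rightarrow> ('v \<Rightarrow> real) \<Rightarrow> 'v \<Rightarrow> real" where
  "laplacian b c f x = (\<Sum>\<^sub>\<infinity>y\<in>UNIV. b x y * (f x - f y)) + c x * f x"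

text \<open>
  Below, \<open>R\<close> is a topological space and \<open>\<iota>\<close> embeds the vertex set into it.
  Functions on subsets of \<open>R\<close> are represented extensionally, so that they are equal
  iff they agree on that subset.
\<close>

definition extends_continuously ::
  "'r topology \<Rightarrow> ('v \<Rightarrow> 'r) \<Rightarrow> ('v \<Rightarrow> real) \<Rightarrow> ('r \<Rightarrow> real) \<Rightarrow> bool" where
  "extends_continuously R \<iota> f g \<longleftrightarrow>
     g \<in> extensional (topspace R) \<and> continuous_map R euclideanreal g \<and> (\<forall>x. g (\<iota> x) = f x)"

definition continuous_ext ::
  "'r topology \<Rightarrow> ('v \<Rightarrow> 'r) \<Rightarrow> ('v \<Rightarrow> real) \<Rightarrow> 'r \<Rightarrow> real" where
  "continuous_ext R \<iota> f = (THE g. extends_continuously R \<iota> f g)"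

text \<open>
  Openness of all singletons \<open>{\<iota> x}\<close> says both that the image of the vertex set is open in \<open>R\<close>
  and that its subspace topology is discrete.
\<close>

definition royden_compactification ::
  "('v \<Rightarrow> 'v \<Rightarrow> real) \<Rightarrow> ('v \<Rightarrow> real) \<Rightarrow> 'r topology \<Rightarrow> ('v \<Rightarrow> 'r) \<Rightarrow> bool" where
  "royden_compactification b c R \<iota> \<longleftrightarrow>
     compact_space R \<and> Hausdorff_space R \<and>
     inj \<iota> \<and> (\<forall>x. openin R {\<iota> x}) \<and> R closure_of (range \<iota>) = topspace R \<and>
     (\<forall>f \<in> D_tilde b c \<inter> ell_infinity. \<exists>!g. extends_continuously R \<iota> f g) \<and>
     (\<forall>p \<in> topspace R. \<forall>q \<in> topspace R. p \<noteq> q \<longrightarrow>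
        (\<exists>f \<in> D_tilde b c \<inter> ell_infinity. continuous_ext R \<iota> f p \<noteq> continuous_ext R \<iota> f q))"

definition royden_algebra ::
  "('v \<Rightarrow> 'v \<Rightarrow> real) \<Rightarrow> ('v \<Rightarrow> real) \<Rightarrow> ('v \<Rightarrow> real) set" where
  "royden_algebra b c =
     norm_closure (sup_norm UNIV) ell_infinity (D_tilde b c \<inter> ell_infinity)"

definition royden_boundary :: "'r topology \<Rightarrow> ('v \<Rightarrow> 'r) \<Rightarrow> 'r set" where
  "royden_boundary R \<iota> = topspace R - range \<iota>"

definition harmonic_boundary ::
  "('v \<Rightarrow> 'v \<Rightarrow> real) \<Rightarrow> ('v \<Rightarrow> real) \<Rightarrow> 'v \<Rightarrow> 'r topology \<Rightarrow> ('v \<Rightarrow> 'r) \<Rightarrow> 'r set" where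
  "harmonic_boundary b c v R \<iota> =
     {p \<in> royden_boundary R \<iota>. \<forall>f \<in> D_tilde0 b c v \<inter> ell_infinity. continuous_ext R \<iota> f p = 0}"

definition C_0_harmonic_boundary ::
  "('v \<Rightarrow> 'v \<Rightarrow> real) \<Rightarrow> ('v \<Rightarrow> real) \<Rightarrow> 'v \<Rightarrow> 'r topology \<Rightarrow> ('v \<Rightarrow> 'r) \<Rightarrow> ('r \<Rightarrow> real) set"
  where
  "C_0_harmonic_boundary b c v R \<iota> =
     {restrict (continuous_ext R \<iota> f) (harmonic_boundary b c v R \<iota>) | f. f \<in> royden_algebra b c}"

definition solves_dirichlet_problem ::
  "('v \<Rightarrow> 'v \<Rightarrow> real) \<Rightarrow> ('v \<Rightarrow> real) \<Rightarrow> 'v \<Rightarrow> 'r topology \<Rightarrow> ('v \<Rightarrow> 'r) \<Rightarrow>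
    ('r \<Rightarrow> real) \<Rightarrow> ('v \<Rightarrow> real) \<Rightarrow> bool" where
  "solves_dirichlet_problem b c v R \<iota> \<phi> f \<longleftrightarrow>
     f \<in> F_tilde b \<and> (\<forall>x. laplacian b c f x = 0) \<and>
     restrict (continuous_ext R \<iota> f) (harmonic_boundary b c v R \<iota>) = \<phi>"

definition dirichlet_solution ::
  "('v \<Rightarrow> 'v \<Rightarrow> real) \<Rightarrow> ('v \<Rightarrow> real) \<Rightarrow> 'v \<Rightarrow> 'r topology \<Rightarrow> ('v \<Rightarrow> 'r) \<Rightarrow>
    ('r \<Rightarrow> real) \<Rightarrow> 'v \<Rightarrow> real" where
  "dirichlet_solution b c v R \<iota> \<phi> =
     (THE f. f \<in> royden_algebra b c \<and> solves_dirichlet_problem b c v R \<iota> \<phi> f)"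

end

theory Submission
  imports Defs
begin

text \<open>
  Uniform transience makes the harmonic boundary equal to the whole Royden boundary, because
  extensions of functions in \<^const>\<open>C_0\<close> vanish there. A harmonic function whose extension attains a
  maximum \<open>M > 0\<close> over the compactification at a vertex is constant by connectedness, hence equal to
  \<open>M\<close> on the (nonempty) boundary as well. This maximum principle gives uniqueness and the
  isometry. For existence it suffices to write \<open>f\<close> as a harmonic function plus an element of
  \<^const>\<open>C_0\<close>. For \<open>f\<close> bounded of finite energy, one minimises the energy of \<open>f - g\<close> over finitely
  supported \<open>g\<close>; minimising sequences converge to an element of \<^const>\<open>D_tilde0\<close>, which lies in
  \<^const>\<open>C_0\<close> by assumption. The general case follows by uniform approximation, since the
  maximum principle bounds the distance of the harmonic parts by the distance of the functions.
\<close>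

section \<open>Sums and norms\<close>

lemma infsum_ennreal_finite_imp_summable:
  fixes f :: "'a \<Rightarrow> real"
  assumes "\<And>x. x \<in> A \<Longrightarrow> f x \<ge> 0" and "infsum (\<lambda>x. ennreal (f x)) A < \<infinity>"
  shows "f summable_on A"
proof -
  obtain r where r: "infsum (\<lambda>x. ennreal (f x)) A = ennreal r" "r \<ge> 0"
    using assms(2) by (metis ennreal_cases infinity_ennreal_def less_irrefl)
  have "sum f F \<le> r" if "finite F" "F \<subseteq> A" for F
  proof -
    have "ennreal (sum f F) = (\<Sum>x\<in>F. ennreal (f x))"
      using that assms(1) by (subst sum_ennreal) auto
    also have "\<dots> \<le> infsum (\<lambda>x. ennreal (f x)) A"
      using that by (subst nonneg_infsum_complete) (auto intro: SUP_upper)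
    finally show ?thesis using r by (simp add: ennreal_le_iff)
  qed
  then show ?thesis
    using assms(1) by (intro nonneg_bdd_above_summable_on) (auto simp: bdd_above_def)
qed

lemma infsum_ennreal_eq_ennreal_infsum:
  fixes f :: "'a \<Rightarrow> real"
  assumes "\<And>x. x \<in> A \<Longrightarrow> f x \<ge> 0" and "f summable_on A"
  shows "infsum (\<lambda>x. ennreal (f x)) A = ennreal (infsum f A)"
proof -
  have "infsum (\<lambda>x. ennreal (f x)) A = (SUP F\<in>{F. finite F \<and> F \<subseteq> A}. (\<Sum>x\<in>F. ennreal (f x)))"
    by (intro nonneg_infsum_complete) auto
  also have "\<dots> = (SUP F\<in>{F. finite F \<and> F \<subseteq> A}. ennreal (sum f F))"
    using assms(1) by (intro SUP_cong refl sum_ennreal) auto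
  also have "\<dots> = ennreal (infsum f A)"
    using infsum_nonneg_is_SUPREMUM_ennreal[OF assms(2,1)] by simp
  finally show ?thesis .
qed

lemma has_sum_diff:
  fixes f g :: "'a \<Rightarrow> real"
  assumes "(f has_sum s) A" and "(g has_sum t) A"
  shows "((\<lambda>x. f x - g x) has_sum (s - t)) A"
  using has_sum_add[OF assms(1) has_sum_cmult_right[OF assms(2), of "-1"]] by simp

lemma has_sum_UNIV_sum:
  fixes f :: "'a + 'b \<Rightarrow> real"
  assumes "((\<lambda>x. f (Inl x)) has_sum s) UNIV" and "((\<lambda>y. f (Inr y)) has_sum t) UNIV"
  shows "(f has_sum (s + t)) UNIV"
proof -
  have "(f has_sum s) (range Inl)" "(f has_sum t) (range Inr)"
    using assms by (simp_all add: has_sum_reindex o_def)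
  then have "(f has_sum (s + t)) (range Inl \<union> range Inr)"
    by (intro has_sum_Un_disjoint) auto
  then show ?thesis by (simp add: UNIV_sum)
qed

lemma summable_on_UNIV_sumD:
  fixes f :: "'a + 'b \<Rightarrow> real"
  assumes "f summable_on UNIV"
  shows "(\<lambda>x. f (Inl x)) summable_on UNIV" and "(\<lambda>y. f (Inr y)) summable_on UNIV"
  using summable_on_subset_banach[OF assms, of "range Inl"]
    summable_on_subset_banach[OF assms, of "range Inr"]
  by (simp_all add: summable_on_reindex o_def)

lemma has_sum_UNIV_row:
  assumes "(f has_sum s) UNIV"
  shows "((\<lambda>(z, y). if z = x then f y else 0) has_sum s) UNIV"
    and "((\<lambda>(z, y). if y = x then f z else 0) has_sum s) UNIV"
proof -
  have "((\<lambda>(z, y). if z = x then f y else 0) has_sum s) (range (Pair x))"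
    "((\<lambda>(z, y). if y = x then f z else 0) has_sum s) (range (\<lambda>z. (z, x)))"
    using assms by (simp_all add: has_sum_reindex inj_on_def o_def)
  moreover have "((\<lambda>(z, y). if z = x then f y else 0) has_sum s) (range (Pair x))
      \<longleftrightarrow> ((\<lambda>(z, y). if z = x then f y else 0) has_sum s) UNIV"
    "((\<lambda>(z, y). if y = x then f z else 0) has_sum s) (range (\<lambda>z. (z, x)))
      \<longleftrightarrow> ((\<lambda>(z, y). if y = x then f z else 0) has_sum s) UNIV"
    by (rule has_sum_cong_neutral; auto split: if_splits)+
  ultimately show "((\<lambda>(z, y). if z = x then f y else 0) has_sum s) UNIV"
    "((\<lambda>(z, y). if y = x then f z else 0) has_sum s) UNIV"
    by blast+
qed

lemma square_le_mult_if_quadratic_nonneg: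
  fixes p q r :: real
  assumes "\<And>t. 0 \<le> p + 2 * t * q + t\<^sup>2 * r" and "r \<ge> 0"
  shows "q\<^sup>2 \<le> p * r"
proof (cases "r = 0")
  case True
  have "q = 0"
  proof (rule ccontr)
    assume "q \<noteq> 0"
    then show False using assms(1)[of "(- p - 1) / (2 * q)"] True by (simp add: field_simps)
  qed
  then show ?thesis using True by simp
next
  case False
  then have "r > 0" using assms(2) by simp
  have "0 \<le> (p + 2 * (- q / r) * q + (- q / r)\<^sup>2 * r) * r"
    using assms(1)[of "- q / r"] \<open>r > 0\<close> by simp
  also have "\<dots> = p * r - q\<^sup>2"
    using \<open>r > 0\<close> by (simp add: field_simps power2_eq_square)
  finally show ?thesis by simp
qed

lemma abs_le_sup_norm:
  assumes "bounded (f ` S)" and "x \<in> S"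
  shows "\<bar>f x\<bar> \<le> sup_norm S f"
proof -
  have "bdd_above ((\<lambda>x. \<bar>f x\<bar>) ` S)"
    using assms(1) unfolding bounded_iff bdd_above_def by auto
  then show ?thesis using assms(2) by (auto simp: sup_norm_def intro: cSUP_upper)
qed

lemma sup_norm_le:
  assumes "\<And>x. x \<in> S \<Longrightarrow> \<bar>f x\<bar> \<le> K" and "K \<ge> 0"
  shows "sup_norm S f \<le> K"
  using assms by (auto simp: sup_norm_def intro: cSUP_least)

lemma ell_infinity_iff: "f \<in> ell_infinity \<longleftrightarrow> (\<exists>K. \<forall>x. \<bar>f x\<bar> \<le> K)"
  by (auto simp: ell_infinity_def bounded_iff)

lemma ell_infinity_diff:
  "f \<in> ell_infinity \<Longrightarrow> g \<in> ell_infinity \<Longrightarrow> (\<lambda>x. f x - g x) \<in> ell_infinity"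
  by (auto simp: ell_infinity_def intro: bounded_minus_comp)

lemma C_c_subset_ell_infinity: "C_c \<subseteq> ell_infinity"
proof
  fix f :: "'v \<Rightarrow> real" assume "f \<in> C_c"
  then have "finite (insert 0 (f ` {x. f x \<noteq> 0}))" by (simp add: C_c_def)
  moreover have "range f \<subseteq> insert 0 (f ` {x. f x \<noteq> 0})" by auto
  ultimately show "f \<in> ell_infinity"
    unfolding ell_infinity_def using finite_imp_bounded finite_subset by blast
qed

lemma sup_norm_closure_iff:
  assumes "B \<subseteq> ell_infinity"
  shows "f \<in> norm_closure (sup_norm UNIV) ell_infinity B \<longleftrightarrow>
    (\<forall>\<epsilon>>0. \<exists>g\<in>B. \<forall>x. \<bar>f x - g x\<bar> \<le> \<epsilon>)" (is "_ \<longleftrightarrow> ?P")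
proof
  assume f: "f \<in> norm_closure (sup_norm UNIV) ell_infinity B"
  show ?P
  proof (intro allI impI)
    fix \<epsilon> :: real assume "\<epsilon> > 0"
    then obtain g where g: "g \<in> B" "sup_norm UNIV (\<lambda>x. f x - g x) < \<epsilon>"
      using f by (auto simp: norm_closure_def)
    have "(\<lambda>x. f x - g x) \<in> ell_infinity"
      using f g assms by (auto simp: norm_closure_def intro: ell_infinity_diff)
    then have "\<bar>f x - g x\<bar> \<le> \<epsilon>" for x
      using abs_le_sup_norm[of "\<lambda>x. f x - g x" UNIV x] g by (auto simp: ell_infinity_def)
    then show "\<exists>g\<in>B. \<forall>x. \<bar>f x - g x\<bar> \<le> \<epsilon>" using g by blast
  qed
next
  assume P: ?P
  have "f \<in> ell_infinity"
  proof -
    obtain g where g: "g \<in> B" "\<forall>x. \<bar>f x - g x\<bar> \<le> 1" using P zero_less_one by blast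
    obtain K where "\<forall>x. \<bar>g x\<bar> \<le> K" using g assms ell_infinity_iff by blast
    then have "\<bar>f x\<bar> \<le> K + 1" for x
      using g(2)[rule_format, of x] \<open>\<forall>x. \<bar>g x\<bar> \<le> K\<close>[rule_format, of x] by linarith
    then show ?thesis using ell_infinity_iff by blast
  qed
  moreover have "\<exists>g\<in>B. sup_norm UNIV (\<lambda>x. f x - g x) < \<epsilon>" if "\<epsilon> > 0" for \<epsilon>
  proof -
    obtain g where "g \<in> B" "\<forall>x. \<bar>f x - g x\<bar> \<le> \<epsilon> / 2" using P \<open>\<epsilon> > 0\<close> by (meson half_gt_zero)
    then show ?thesis
      using sup_norm_le[of UNIV "\<lambda>x. f x - g x" "\<epsilon> / 2"] \<open>\<epsilon> > 0\<close> by force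
  qed
  ultimately show "f \<in> norm_closure (sup_norm UNIV) ell_infinity B"
    by (auto simp: norm_closure_def)
qed

lemmas C_0_iff = sup_norm_closure_iff[OF C_c_subset_ell_infinity, folded C_0_def]

lemma royden_algebra_iff:
  "f \<in> royden_algebra b c \<longleftrightarrow>
    (\<forall>\<epsilon>>0. \<exists>g\<in>D_tilde b c \<inter> ell_infinity. \<forall>x. \<bar>f x - g x\<bar> \<le> \<epsilon>)"
  unfolding royden_algebra_def by (rule sup_norm_closure_iff) simp

lemma C_0_subset_ell_infinity: "C_0 \<subseteq> ell_infinity"
  by (auto simp: C_0_def norm_closure_def)

lemma royden_algebra_subset_ell_infinity: "royden_algebra b c \<subseteq> ell_infinity"
  by (auto simp: royden_algebra_def norm_closure_def)

lemma C_0_finite_superlevel: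
  assumes "f \<in> C_0" and "\<epsilon> > 0"
  shows "finite {x. \<bar>f x\<bar> > \<epsilon>}"
proof -
  obtain g where "g \<in> C_c" "\<forall>x. \<bar>f x - g x\<bar> \<le> \<epsilon>" using assms by (auto simp: C_0_iff)
  then have "finite {x. g x \<noteq> 0}" "{x. \<bar>f x\<bar> > \<epsilon>} \<subseteq> {x. g x \<noteq> 0}"
    by (auto simp: C_c_def) (metis diff_zero not_less)
  then show ?thesis by (rule finite_subset[rotated])
qed

lemma C_0_uniform_limit:
  assumes "\<And>\<epsilon>. \<epsilon> > 0 \<Longrightarrow> \<exists>g\<in>C_0. \<forall>x. \<bar>f x - g x\<bar> \<le> \<epsilon>"
  shows "f \<in> C_0"
  unfolding C_0_iff
proof (intro allI impI)
  fix \<epsilon> :: real assume "\<epsilon> > 0"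
  then obtain g where g: "g \<in> C_0" "\<forall>x. \<bar>f x - g x\<bar> \<le> \<epsilon> / 2" using assms[of "\<epsilon> / 2"] by auto
  then obtain k where k: "k \<in> C_c" "\<forall>x. \<bar>g x - k x\<bar> \<le> \<epsilon> / 2"
    using \<open>\<epsilon> > 0\<close> unfolding C_0_iff by (meson half_gt_zero)
  have "\<bar>f x - k x\<bar> \<le> \<epsilon>" for x
    using g(2)[rule_format, of x] k(2)[rule_format, of x] by linarith
  then show "\<exists>k\<in>C_c. \<forall>x. \<bar>f x - k x\<bar> \<le> \<epsilon>" using k by blast
qed

section \<open>The energy form\<close>

locale graph =
  fixes b :: "'v \<Rightarrow> 'v \<Rightarrow> real" and c :: "'v \<Rightarrow> real"
  assumes wg: "weighted_graph b c"
begin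

lemma b_nonneg: "b x y \<ge> 0" and b_sym: "b x y = b y x" and b_refl [simp]: "b x x = 0"
  and b_summable: "b x summable_on UNIV" and c_nonneg: "c x \<ge> 0"
  using wg by (auto simp: weighted_graph_def)

text \<open>The energy of \<open>u\<close> is the squared \<open>\<ell>\<^sup>2\<close> norm of \<open>gradient u\<close>, which is linear in \<open>u\<close>.\<close>

definition gradient :: "('v \<Rightarrow> real) \<Rightarrow> 'v \<times> 'v + 'v \<Rightarrow> real" where
  "gradient u i = (case i of
      Inl (x, y) \<Rightarrow> sqrt (b x y / 2) * (u x - u y)
    | Inr x \<Rightarrow> sqrt (c x) * u x)"

definition energy :: "('v \<Rightarrow> real) \<Rightarrow> ('v \<Rightarrow> real) \<Rightarrow> real" where
  "energy u w = (\<Sum>\<^sub>\<infinity>i. gradient u i * gradient w i)"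

lemma gradient_add: "gradient (\<lambda>x. u x + w x) i = gradient u i + gradient w i"
  and gradient_diff: "gradient (\<lambda>x. u x - w x) i = gradient u i - gradient w i"
  and gradient_scale: "gradient (\<lambda>x. t * u x) i = t * gradient u i"
  by (auto simp: gradient_def algebra_simps split: sum.splits)

lemma gradient_zero [simp]: "gradient (\<lambda>x. 0) i = 0"
  by (auto simp: gradient_def split: sum.splits)

lemma gradient_square:
  "(gradient u (Inl z))\<^sup>2 = b (fst z) (snd z) * (u (fst z) - u (snd z))\<^sup>2 / 2"
  "(gradient u (Inr x))\<^sup>2 = c x * (u x)\<^sup>2"
  using b_nonneg c_nonneg by (simp_all add: gradient_def power_mult_distrib split_beta)

lemma tendsto_gradient:
  assumes "\<And>x. (\<lambda>n. u n x) \<longlonglongrightarrow> w x"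
  shows "(\<lambda>n. gradient (u n) i) \<longlonglongrightarrow> gradient w i"
  by (cases i) (auto simp: gradient_def intro!: tendsto_intros assms)

lemma Q_tilde_eq_energy:
  assumes "(\<lambda>i. (gradient u i)\<^sup>2) summable_on UNIV"
  shows "Q_tilde b c u = ennreal (energy u u)"
proof -
  have 1: "(\<lambda>(x, y). b x y * \<bar>u x - u y\<bar>\<^sup>2 / 2) summable_on UNIV"
    and 2: "(\<lambda>x. c x * \<bar>u x\<bar>\<^sup>2) summable_on UNIV"
    using summable_on_UNIV_sumD[OF assms] by (simp_all add: gradient_square case_prod_beta')
  have 3: "(\<lambda>(x, y). b x y * \<bar>u x - u y\<bar>\<^sup>2) summable_on UNIV"
    using summable_on_cmult_right[OF 1, of 2] by (simp add: case_prod_beta')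
  have "((\<lambda>i. (gradient u i)\<^sup>2) has_sum
      (\<Sum>\<^sub>\<infinity>(x, y). b x y * \<bar>u x - u y\<bar>\<^sup>2 / 2) + (\<Sum>\<^sub>\<infinity>x. c x * \<bar>u x\<bar>\<^sup>2)) UNIV"
    using has_sum_infsum[OF 1] has_sum_infsum[OF 2]
    by (intro has_sum_UNIV_sum) (auto simp: gradient_square case_prod_beta')
  then have "energy u u =
      (\<Sum>\<^sub>\<infinity>(x, y). b x y * \<bar>u x - u y\<bar>\<^sup>2 / 2) + (\<Sum>\<^sub>\<infinity>x. c x * \<bar>u x\<bar>\<^sup>2)"
    by (simp add: energy_def power2_eq_square infsumI)
  also have "(\<Sum>\<^sub>\<infinity>(x, y). b x y * \<bar>u x - u y\<bar>\<^sup>2 / 2) = 1 / 2 * (\<Sum>\<^sub>\<infinity>(x, y). b x y * \<bar>u x - u y\<bar>\<^sup>2)"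
    by (subst infsum_cmult_right'[symmetric]) (simp add: case_prod_beta')
  finally have E: "energy u u =
     1 / 2 * (\<Sum>\<^sub>\<infinity>(x, y). b x y * \<bar>u x - u y\<bar>\<^sup>2) + (\<Sum>\<^sub>\<infinity>x. c x * \<bar>u x\<bar>\<^sup>2)" .
  have 4: "(\<Sum>\<^sub>\<infinity>(x, y)\<in>UNIV. ennreal (b x y * \<bar>u x - u y\<bar>\<^sup>2))
      = ennreal (\<Sum>\<^sub>\<infinity>(x, y). b x y * \<bar>u x - u y\<bar>\<^sup>2)"
    using infsum_ennreal_eq_ennreal_infsum[OF _ 3] b_nonneg by (auto simp: case_prod_beta')
  have 5: "(\<Sum>\<^sub>\<infinity>x\<in>UNIV. ennreal (c x * \<bar>u x\<bar>\<^sup>2)) = ennreal (\<Sum>\<^sub>\<infinity>x. c x * \<bar>u x\<bar>\<^sup>2)"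
    using infsum_ennreal_eq_ennreal_infsum[OF _ 2] c_nonneg by auto
  have half: "(1 / 2 :: ennreal) = ennreal (1 / 2)"
    by (metis divide_ennreal ennreal_1 ennreal_numeral zero_le_numeral zero_less_numeral zero_less_one_class.zero_le_one)
  have nonneg: "(\<Sum>\<^sub>\<infinity>(x, y). b x y * \<bar>u x - u y\<bar>\<^sup>2) \<ge> 0" "(\<Sum>\<^sub>\<infinity>x. c x * \<bar>u x\<bar>\<^sup>2) \<ge> 0"
    using b_nonneg c_nonneg by (auto intro!: infsum_nonneg)
  have halve: "ennreal (1 / 2) * ennreal p + ennreal q = ennreal (1 / 2 * p + q)"
    if "p \<ge> 0" "q \<ge> 0" for p q :: real
  proof -
    have "ennreal (1 / 2 * p + q) = ennreal (1 / 2 * p) + ennreal q"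
      using that by (intro ennreal_plus) auto
    also have "ennreal (1 / 2 * p) = ennreal (1 / 2) * ennreal p"
      using that by (intro ennreal_mult) auto
    finally show ?thesis by (rule sym)
  qed
  show ?thesis
    unfolding Q_tilde_def 4 5 E half by (rule halve[OF nonneg])
qed

lemma D_tilde_iff: "u \<in> D_tilde b c \<longleftrightarrow> (\<lambda>i. (gradient u i)\<^sup>2) summable_on UNIV"
proof
  assume "u \<in> D_tilde b c"
  then have "(1 / 2) * (\<Sum>\<^sub>\<infinity>(x, y)\<in>UNIV. ennreal (b x y * \<bar>u x - u y\<bar>\<^sup>2)) < \<infinity>"
    and 2: "(\<Sum>\<^sub>\<infinity>x\<in>UNIV. ennreal (c x * \<bar>u x\<bar>\<^sup>2)) < \<infinity>"
    by (auto simp: D_tilde_def Q_tilde_def)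
  then have "(\<Sum>\<^sub>\<infinity>(x, y)\<in>UNIV. ennreal (b x y * \<bar>u x - u y\<bar>\<^sup>2)) < \<infinity>"
    by (auto simp: ennreal_mult_less_top ennreal_divide_eq_0_iff)
  then have 3: "(\<lambda>z. b (fst z) (snd z) * \<bar>u (fst z) - u (snd z)\<bar>\<^sup>2) summable_on UNIV"
    using b_nonneg by (intro infsum_ennreal_finite_imp_summable) (auto simp: case_prod_beta')
  have "(\<lambda>x. c x * \<bar>u x\<bar>\<^sup>2) summable_on UNIV"
    using 2 c_nonneg by (intro infsum_ennreal_finite_imp_summable) auto
  moreover have "(\<lambda>z. (gradient u (Inl z))\<^sup>2) summable_on UNIV"
    using summable_on_cmult_right[OF 3, of "1 / 2"] by (simp add: gradient_square)
  ultimately show "(\<lambda>i. (gradient u i)\<^sup>2) summable_on UNIV"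
    using has_sum_UNIV_sum[of "\<lambda>i. (gradient u i)\<^sup>2"] 
    by (auto simp: summable_on_def gradient_square)
qed (simp add: D_tilde_def Q_tilde_eq_energy)

lemma enn2real_Q_tilde: "u \<in> D_tilde b c \<Longrightarrow> enn2real (Q_tilde b c u) = energy u u"
  by (simp add: D_tilde_iff Q_tilde_eq_energy energy_def infsum_nonneg)

lemma summable_gradient_mult:
  assumes "u \<in> D_tilde b c" and "w \<in> D_tilde b c"
  shows "(\<lambda>i. gradient u i * gradient w i) summable_on UNIV"
proof (rule abs_summable_summable)
  have sum: "(\<lambda>i. (gradient u i)\<^sup>2 + (gradient w i)\<^sup>2) summable_on UNIV"
    using assms by (intro summable_on_add) (simp_all add: D_tilde_iff)
  have le: "norm (p * q) \<le> p\<^sup>2 + q\<^sup>2" for p q :: real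
  proof -
    have "0 \<le> (\<bar>p\<bar> - \<bar>q\<bar>)\<^sup>2" "0 \<le> \<bar>p\<bar> * \<bar>q\<bar>" by simp_all
    then show ?thesis unfolding power2_diff power2_abs real_norm_def abs_mult by linarith
  qed
  show "(\<lambda>i. norm (gradient u i * gradient w i)) summable_on UNIV"
    using sum by (rule summable_on_comparison_test) (rule le norm_ge_zero)+
qed

lemma has_sum_energy:
  assumes "u \<in> D_tilde b c" and "w \<in> D_tilde b c"
  shows "((\<lambda>i. gradient u i * gradient w i) has_sum energy u w) UNIV"
  unfolding energy_def using summable_gradient_mult[OF assms] by (rule has_sum_infsum)

lemma energy_nonneg: "energy u u \<ge> 0"
  unfolding energy_def by (rule infsum_nonneg) simp

lemma has_sum_energy_quadratic:
  assumes "u \<in> D_tilde b c" and "w \<in> D_tilde b c"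
  shows "((\<lambda>i. (gradient (\<lambda>x. u x + t * w x) i)\<^sup>2) has_sum
    energy u u + 2 * t * energy u w + t\<^sup>2 * energy w w) UNIV"
proof -
  have "((\<lambda>i. gradient u i * gradient u i + 2 * t * (gradient u i * gradient w i)
      + t\<^sup>2 * (gradient w i * gradient w i)) has_sum
    energy u u + 2 * t * energy u w + t\<^sup>2 * energy w w) UNIV"
    using assms by (intro has_sum_add has_sum_cmult_right has_sum_energy)
  moreover have "gradient u i * gradient u i + 2 * t * (gradient u i * gradient w i)
      + t\<^sup>2 * (gradient w i * gradient w i) = (gradient (\<lambda>x. u x + t * w x) i)\<^sup>2" for i
    by (simp add: gradient_add gradient_scale power2_eq_square algebra_simps)
  ultimately show ?thesis by (simp only:)
qed

lemma D_tilde_add_scale: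
  "u \<in> D_tilde b c \<Longrightarrow> w \<in> D_tilde b c \<Longrightarrow> (\<lambda>x. u x + t * w x) \<in> D_tilde b c"
  unfolding D_tilde_iff[of "\<lambda>x. u x + t * w x"]
  by (rule has_sum_imp_summable, rule has_sum_energy_quadratic)

lemma energy_add_scale:
  "u \<in> D_tilde b c \<Longrightarrow> w \<in> D_tilde b c \<Longrightarrow>
    energy (\<lambda>x. u x + t * w x) (\<lambda>x. u x + t * w x) =
    energy u u + 2 * t * energy u w + t\<^sup>2 * energy w w"
  using has_sum_energy_quadratic[of u w t] 
  by (simp add: energy_def[of "\<lambda>x. u x + t * w x"] power2_eq_square infsumI)

lemma zero_in_D_tilde: "(\<lambda>x. 0) \<in> D_tilde b c"
  by (simp add: D_tilde_iff)

lemma D_tilde_diff: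
  "u \<in> D_tilde b c \<Longrightarrow> w \<in> D_tilde b c \<Longrightarrow> (\<lambda>x. u x - w x) \<in> D_tilde b c"
  using D_tilde_add_scale[of u w "-1"] by simp

lemma D_tilde_add:
  "u \<in> D_tilde b c \<Longrightarrow> w \<in> D_tilde b c \<Longrightarrow> (\<lambda>x. u x + w x) \<in> D_tilde b c"
  using D_tilde_add_scale[of u w 1] by simp

lemma energy_parallelogram:
  assumes "u \<in> D_tilde b c" "w \<in> D_tilde b c"
  shows "energy (\<lambda>x. u x - w x) (\<lambda>x. u x - w x) + energy (\<lambda>x. u x + w x) (\<lambda>x. u x + w x)
    = 2 * energy u u + 2 * energy w w"
  using energy_add_scale[OF assms, of 1] energy_add_scale[OF assms, of "-1"] by simp

lemma energy_zero_left [simp]: "energy (\<lambda>x. 0) u = 0"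
  by (simp add: energy_def)

lemma energy_scale:
  "u \<in> D_tilde b c \<Longrightarrow> energy (\<lambda>x. t * u x) (\<lambda>x. t * u x) = t\<^sup>2 * energy u u"
  using energy_add_scale[OF zero_in_D_tilde, of u t] by simp

lemma energy_Cauchy_Schwarz:
  assumes "u \<in> D_tilde b c" "w \<in> D_tilde b c"
  shows "(energy u w)\<^sup>2 \<le> energy u u * energy w w"
proof (rule square_le_mult_if_quadratic_nonneg)
  show "0 \<le> energy u u + 2 * t * energy u w + t\<^sup>2 * energy w w" for t
    using energy_nonneg[of "\<lambda>x. u x + t * w x"] energy_add_scale[OF assms] by simp
qed (rule energy_nonneg)

lemma energy_Fatou:
  assumes lim: "\<And>x. (\<lambda>n. u n x) \<longlonglongrightarrow> w x"
    and u: "\<forall>\<^sub>F n in sequentially. u n \<in> D_tilde b c \<and> energy (u n) (u n) \<le> K"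
  shows "w \<in> D_tilde b c" and "energy w w \<le> K"
proof -
  have le: "(\<Sum>i\<in>F. (gradient w i)\<^sup>2) \<le> K" if "finite F" for F
  proof (rule tendsto_upperbound)
    show "(\<lambda>n. \<Sum>i\<in>F. (gradient (u n) i)\<^sup>2) \<longlonglongrightarrow> (\<Sum>i\<in>F. (gradient w i)\<^sup>2)"
      using lim by (intro tendsto_intros tendsto_gradient)
    show "\<forall>\<^sub>F n in sequentially. (\<Sum>i\<in>F. (gradient (u n) i)\<^sup>2) \<le> K"
      using u
    proof eventually_elim
      case (elim n)
      then have "(\<Sum>i\<in>F. (gradient (u n) i)\<^sup>2) \<le> (\<Sum>\<^sub>\<infinity>i. (gradient (u n) i)\<^sup>2)"
        using that by (intro finite_sum_le_infsum) (auto simp: D_tilde_iff)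
      also have "\<dots> = energy (u n) (u n)" by (simp add: energy_def power2_eq_square)
      finally show ?case using elim by simp
    qed
  qed simp
  then show "w \<in> D_tilde b c"
    unfolding D_tilde_iff by (intro nonneg_bdd_above_summable_on) (auto simp: bdd_above_def)
  then show "energy w w \<le> K"
    unfolding D_tilde_iff energy_def
    using le by (intro infsum_le_finite_sums) (auto simp: power2_eq_square)
qed

lemma increment_le_energy:
  assumes "u \<in> D_tilde b c"
  shows "b x y * (u x - u y)\<^sup>2 \<le> 2 * energy u u"
proof -
  have "(\<Sum>i\<in>{Inl (x, y)}. (gradient u i)\<^sup>2) \<le> (\<Sum>\<^sub>\<infinity>i. (gradient u i)\<^sup>2)"
    using assms by (intro finite_sum_le_infsum) (auto simp: D_tilde_iff)
  moreover have "(\<Sum>\<^sub>\<infinity>i. (gradient u i)\<^sup>2) = energy u u"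
    by (simp add: energy_def power2_eq_square)
  ultimately show ?thesis by (simp add: gradient_square)
qed

lemma laplacian_has_sum:
  assumes "u \<in> ell_infinity"
  shows "((\<lambda>y. b x y * (u x - u y)) has_sum (laplacian b c u x - c x * u x)) UNIV"
proof -
  obtain K where K: "\<And>y. \<bar>u y\<bar> \<le> K" using assms ell_infinity_iff by blast
  have "(\<lambda>y. norm (b x y * (u x - u y))) summable_on UNIV"
  proof (rule summable_on_comparison_test)
    show "(\<lambda>y. b x y * (2 * K)) summable_on UNIV"
      using b_summable by (rule summable_on_cmult_left)
    show "norm (b x y * (u x - u y)) \<le> b x y * (2 * K)" for y
      using K[of x] K[of y] b_nonneg[of x y] by (auto simp: abs_mult intro!: mult_left_mono)
  qed auto
  then have "(\<lambda>y. b x y * (u x - u y)) summable_on UNIV" by (rule abs_summable_summable)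
  then show ?thesis by (simp add: laplacian_def has_sum_infsum)
qed

lemma ell_infinity_subset_F_tilde: "ell_infinity \<subseteq> F_tilde b"
proof
  fix u :: "'v \<Rightarrow> real" assume "u \<in> ell_infinity"
  then obtain K where K: "\<And>y. \<bar>u y\<bar> \<le> K" using ell_infinity_iff by blast
  have "(\<lambda>y. b x y * \<bar>u y\<bar>) summable_on UNIV" for x
  proof (rule summable_on_comparison_test)
    show "(\<lambda>y. b x y * K) summable_on UNIV" using b_summable by (rule summable_on_cmult_left)
  qed (use K b_nonneg in \<open>auto intro!: mult_left_mono\<close>)
  then show "u \<in> F_tilde b" by (simp add: F_tilde_def)
qed

lemma laplacian_diff:
  assumes "u \<in> ell_infinity" "w \<in> ell_infinity"
  shows "laplacian b c (\<lambda>x. u x - w x) x = laplacian b c u x - laplacian b c w x"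
proof -
  have "((\<lambda>y. b x y * (u x - u y) - b x y * (w x - w y)) has_sum
     (laplacian b c u x - c x * u x) - (laplacian b c w x - c x * w x)) UNIV"
    using assms by (intro has_sum_diff laplacian_has_sum)
  then have "(\<Sum>\<^sub>\<infinity>y. b x y * (u x - u y) - b x y * (w x - w y)) =
    (laplacian b c u x - c x * u x) - (laplacian b c w x - c x * w x)" by (rule infsumI)
  then show ?thesis by (simp add: laplacian_def[of b c "\<lambda>x. u x - w x"] algebra_simps)
qed

lemma abs_laplacian_le:
  assumes "\<And>y. \<bar>u y\<bar> \<le> K"
  shows "\<bar>laplacian b c u x\<bar> \<le> (2 * infsum (b x) UNIV + c x) * K"
proof -
  have u: "u \<in> ell_infinity" using assms ell_infinity_iff by blast
  have "((\<lambda>y. b x y * (2 * K)) has_sum (infsum (b x) UNIV * (2 * K))) UNIV"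
    using b_summable by (intro has_sum_cmult_left has_sum_infsum)
  moreover have *: "\<bar>b x y * (u x - u y)\<bar> \<le> b x y * (2 * K)" for y
    using assms[of x] assms[of y] b_nonneg[of x y] by (auto simp: abs_mult intro!: mult_left_mono)
  ultimately have "\<bar>laplacian b c u x - c x * u x\<bar> \<le> infsum (b x) UNIV * (2 * K)"
    using norm_infsum_le[OF laplacian_has_sum[OF u]] by simp
  moreover have "\<bar>c x * u x\<bar> \<le> c x * K"
    using assms[of x] c_nonneg by (auto simp: abs_mult intro!: mult_left_mono)
  ultimately show ?thesis by (simp add: algebra_simps)
qed

lemma has_sum_gradient_mult_indicator:
  assumes "u \<in> ell_infinity"
  shows "((\<lambda>i. gradient u i * gradient (indicator {x}) i) has_sum laplacian b c u x) UNIV"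
proof -
  let ?s = "(laplacian b c u x - c x * u x) / 2"
  let ?f = "\<lambda>y. b x y * (u x - u y) / 2"
  have f: "(?f has_sum ?s) UNIV"
    using has_sum_cmult_left[OF laplacian_has_sum[OF assms], of x "1 / 2"] by simp
  have "((\<lambda>p. (case p of (z, y) \<Rightarrow> if z = x then ?f y else 0)
      + (case p of (z, y) \<Rightarrow> if y = x then ?f z else 0)) has_sum ?s + ?s) UNIV"
    using has_sum_UNIV_row[OF f] by (intro has_sum_add)
  moreover have "(case p of (z, y) \<Rightarrow> if z = x then ?f y else 0)
      + (case p of (z, y) \<Rightarrow> if y = x then ?f z else 0)
      = gradient u (Inl p) * gradient (indicator {x}) (Inl p)" for p
    using b_nonneg b_sym[of "fst p" "snd p"]
    by (cases p) (auto simp: gradient_def indicator_def field_simps)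
  ultimately have 1: "((\<lambda>p. gradient u (Inl p) * gradient (indicator {x}) (Inl p))
      has_sum ?s + ?s) UNIV"
    by simp
  have "gradient u (Inr x) * gradient (indicator {x}) (Inr x) = (sqrt (c x))\<^sup>2 * u x"
    by (simp add: gradient_def power2_eq_square)
  then have "((\<lambda>y. gradient u (Inr y) * gradient (indicator {x}) (Inr y)) has_sum c x * u x) {x}"
    using has_sum_finite[of "{x}" "\<lambda>y. gradient u (Inr y) * gradient (indicator {x}) (Inr y)"]
    by (simp add: c_nonneg)
  moreover have "((\<lambda>y. gradient u (Inr y) * gradient (indicator {x}) (Inr y)) has_sum c x * u x) {x}
    \<longleftrightarrow> ((\<lambda>y. gradient u (Inr y) * gradient (indicator {x}) (Inr y)) has_sum c x * u x) UNIV"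
    by (rule has_sum_cong_neutral) (auto simp: gradient_def)
  ultimately have 2: "((\<lambda>y. gradient u (Inr y) * gradient (indicator {x}) (Inr y))
      has_sum c x * u x) UNIV" by simp
  show ?thesis using has_sum_UNIV_sum[OF 1 2] by simp
qed

lemma energy_indicator: "u \<in> ell_infinity \<Longrightarrow> energy u (indicator {x}) = laplacian b c u x"
  unfolding energy_def by (intro infsumI has_sum_gradient_mult_indicator)

lemma indicator_in_D_tilde: "indicator {x} \<in> D_tilde b c"
proof -
  have "indicator {x} \<in> ell_infinity"
    by (auto simp: ell_infinity_iff indicator_def intro!: exI[of _ 1])
  then show ?thesis
    unfolding D_tilde_iff power2_eq_square
    by (rule has_sum_imp_summable[OF has_sum_gradient_mult_indicator])
qed

lemma C_c_subset_D_tilde: "C_c \<subseteq> D_tilde b c"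
proof
  fix f :: "'v \<Rightarrow> real" assume "f \<in> C_c"
  then have fin: "finite {x. f x \<noteq> 0}" by (simp add: C_c_def)
  have "(\<lambda>x. \<Sum>y\<in>F. f y * indicator {y} x) \<in> D_tilde b c" if "finite F" for F
    using that
  proof induction
    case (insert z F)
    then show ?case
      using D_tilde_add_scale[OF insert.IH indicator_in_D_tilde[of z], of "f z"]
      unfolding sum.insert[OF insert.hyps] by (simp only: add.commute)
  qed (simp add: zero_in_D_tilde)
  moreover have "(\<Sum>y\<in>{x. f x \<noteq> 0}. f y * indicator {y} x) = f x" for x
    using fin by (simp add: indicator_def if_distrib Int_insert_right cong: if_cong)
  ultimately show "f \<in> D_tilde b c" using fin by force
qed

lemma C_0_subset_royden_algebra: "C_0 \<subseteq> royden_algebra b c"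
  unfolding subset_iff C_0_iff royden_algebra_iff
  using C_c_subset_D_tilde C_c_subset_ell_infinity by blast

lemma D_tilde0_iff:
  "f \<in> D_tilde0 b c v \<longleftrightarrow> f \<in> D_tilde b c \<and>
    (\<forall>\<epsilon>>0. \<exists>g\<in>C_c. sqrt (energy (\<lambda>x. f x - g x) (\<lambda>x. f x - g x) + (f v - g v)\<^sup>2) < \<epsilon>)"
proof -
  have "D_norm b c v (\<lambda>x. f x - g x) =
      sqrt (energy (\<lambda>x. f x - g x) (\<lambda>x. f x - g x) + (f v - g v)\<^sup>2)"
    if "f \<in> D_tilde b c" "g \<in> C_c" for g
    using that C_c_subset_D_tilde
    by (subst D_norm_def) (auto simp: enn2real_Q_tilde D_tilde_diff subset_iff)
  then show ?thesis by (auto simp: D_tilde0_def norm_closure_def)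
qed

lemma D_tilde0I:
  assumes g: "\<And>n. g n \<in> C_c" and f: "f \<in> D_tilde b c"
    and E: "(\<lambda>n. energy (\<lambda>x. f x - g n x) (\<lambda>x. f x - g n x)) \<longlonglongrightarrow> 0"
    and v: "(\<lambda>n. g n v) \<longlonglongrightarrow> f v"
  shows "f \<in> D_tilde0 b c v"
  unfolding D_tilde0_iff
proof (intro conjI allI impI)
  fix \<epsilon> :: real assume "\<epsilon> > 0"
  have "(\<lambda>n. sqrt (energy (\<lambda>x. f x - g n x) (\<lambda>x. f x - g n x) + (f v - g n v)\<^sup>2))
      \<longlonglongrightarrow> sqrt (0 + (f v - f v)\<^sup>2)"
    by (intro tendsto_intros E v)
  then have "\<forall>\<^sub>F n in sequentially.
      sqrt (energy (\<lambda>x. f x - g n x) (\<lambda>x. f x - g n x) + (f v - g n v)\<^sup>2) < \<epsilon>"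
    using \<open>\<epsilon> > 0\<close> by (intro order_tendstoD) auto
  then show "\<exists>g\<in>C_c. sqrt (energy (\<lambda>x. f x - g x) (\<lambda>x. f x - g x) + (f v - g v)\<^sup>2) < \<epsilon>"
    using g by (auto simp: eventually_sequentially)
qed (rule f)

lemma royden_algebra_diff:
  assumes "f \<in> royden_algebra b c" and "g \<in> royden_algebra b c"
  shows "(\<lambda>x. f x - g x) \<in> royden_algebra b c"
  unfolding royden_algebra_iff
proof (intro allI impI)
  fix \<epsilon> :: real assume "\<epsilon> > 0"
  then obtain f' g' where f': "f' \<in> D_tilde b c \<inter> ell_infinity" "\<And>x. \<bar>f x - f' x\<bar> \<le> \<epsilon> / 2"
    and g': "g' \<in> D_tilde b c \<inter> ell_infinity" "\<And>x. \<bar>g x - g' x\<bar> \<le> \<epsilon> / 2"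
    using assms unfolding royden_algebra_iff by (meson half_gt_zero)
  have "\<bar>(f x - g x) - (f' x - g' x)\<bar> \<le> \<epsilon>" for x
    using f'(2)[of x] g'(2)[of x] by linarith
  moreover have "(\<lambda>x. f' x - g' x) \<in> D_tilde b c \<inter> ell_infinity"
    using f' g' by (simp add: D_tilde_diff ell_infinity_diff)
  ultimately show "\<exists>k\<in>D_tilde b c \<inter> ell_infinity. \<forall>x. \<bar>(f x - g x) - k x\<bar> \<le> \<epsilon>"
    by (intro bexI[of _ "\<lambda>x. f' x - g' x"] allI)
qed

lemma royden_algebra_bounded: "f \<in> royden_algebra b c \<Longrightarrow> f \<in> ell_infinity"
  using royden_algebra_subset_ell_infinity by blast

end

section \<open>The Royden decomposition\<close>

lemma C_c_diff: "f \<in> C_c \<Longrightarrow> g \<in> C_c \<Longrightarrow> (\<lambda>x. f x - g x) \<in> C_c"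
  unfolding C_c_def mem_Collect_eq
  by (rule finite_subset[of _ "{x. f x \<noteq> 0} \<union> {x. g x \<noteq> 0}"]) auto

lemma C_c_add_scale: "f \<in> C_c \<Longrightarrow> g \<in> C_c \<Longrightarrow> (\<lambda>x. f x + t * g x) \<in> C_c"
  unfolding C_c_def mem_Collect_eq
  by (rule finite_subset[of _ "{x. f x \<noteq> 0} \<union> {x. g x \<noteq> 0}"]) auto

lemma indicator_in_C_c: "indicator {x} \<in> C_c"
  by (simp add: C_c_def indicator_def)

lemma inverse_Suc_tendsto_0: "(\<lambda>n. K / real (Suc n)) \<longlonglongrightarrow> 0"
  using tendsto_mult_left[OF LIMSEQ_inverse_real_of_nat, of K] by (simp add: divide_inverse)

lemma tendsto_0_if_le_inverse_Suc:
  fixes a :: "nat \<Rightarrow> real"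
  assumes "\<And>n. 0 \<le> a n" and "\<And>n. a n \<le> K / real (Suc n)"
  shows "a \<longlonglongrightarrow> 0"
  by (rule tendsto_sandwich[OF always_eventually always_eventually tendsto_const
        inverse_Suc_tendsto_0[of K]]) (intro allI assms)+

lemma square_add_le: "(p + q)\<^sup>2 \<le> 2 * p\<^sup>2 + 2 * (q::real)\<^sup>2"
  using zero_le_power2[of "p - q"] by (simp add: power2_sum power2_diff)

locale transient_graph = graph b c
  for b :: "'v \<Rightarrow> 'v \<Rightarrow> real" and c +
  fixes v :: 'v
  assumes infinite_vertices: "infinite (UNIV :: 'v set)"
    and connected: "graph_connected b"
    and uniformly_transient: "uniformly_transient b c v"
begin

lemma D_tilde0_subset_C_0: "D_tilde0 b c v \<subseteq> C_0"
  using uniformly_transient by (simp add: uniformly_transient_def)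

lemma one_notin_D_tilde0: "(\<lambda>x. 1) \<notin> D_tilde0 b c v"
proof
  assume "(\<lambda>x. 1) \<in> D_tilde0 b c v"
  then have "(\<lambda>x::'v. 1::real) \<in> C_0" using D_tilde0_subset_C_0 by blast
  then have "finite {x::'v. \<bar>1::real\<bar> > 1 / 2}" by (rule C_0_finite_superlevel) simp
  then show False using infinite_vertices by simp
qed

lemma path_increment_bound:
  assumes "\<forall>i\<in>{1..n::nat}. b (w (i - 1)) (w i) > 0"
  shows "\<exists>C\<ge>0. \<forall>u\<in>D_tilde b c. (u (w n) - u (w 0))\<^sup>2 \<le> C * energy u u"
  using assms
proof (induction n)
  case 0
  show ?case by (intro exI[of _ 0]) simp
next
  case (Suc n)
  from Suc.prems have pos: "b (w n) (w (Suc n)) > 0" by force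
  from Suc.prems have "\<forall>i\<in>{1..n}. b (w (i - 1)) (w i) > 0" by simp
  then obtain C where C: "C \<ge> 0" "\<forall>u\<in>D_tilde b c. (u (w n) - u (w 0))\<^sup>2 \<le> C * energy u u"
    using Suc.IH by blast
  let ?B = "2 / b (w n) (w (Suc n))"
  have "(u (w (Suc n)) - u (w 0))\<^sup>2 \<le> (2 * ?B + 2 * C) * energy u u" if "u \<in> D_tilde b c" for u
  proof -
    have "(u (w (Suc n)) - u (w n))\<^sup>2 \<le> ?B * energy u u"
      using increment_le_energy[OF that, of "w n" "w (Suc n)"] pos
      by (simp add: field_simps power2_commute)
    moreover have "(u (w (Suc n)) - u (w 0))\<^sup>2 \<le>
        2 * (u (w (Suc n)) - u (w n))\<^sup>2 + 2 * (u (w n) - u (w 0))\<^sup>2"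
      using square_add_le[of "u (w (Suc n)) - u (w n)" "u (w n) - u (w 0)"] by simp
    ultimately show ?thesis using C(2) that by (fastforce simp only: distrib_right mult.assoc)
  qed
  moreover have "2 * ?B + 2 * C \<ge> 0" using pos C by simp
  ultimately show ?case by blast
qed

lemma increment_bound:
  obtains C where "C \<ge> 0" "\<And>u. u \<in> D_tilde b c \<Longrightarrow> (u y - u x)\<^sup>2 \<le> C * energy u u"
proof (cases "x = y")
  case True
  then show ?thesis using that[of 0] by simp
next
  case False
  then obtain n :: nat and w where w: "w 0 = x" "w n = y" "\<forall>i\<in>{1..n}. b (w (i - 1)) (w i) > 0"
    using connected unfolding graph_connected_def by blast
  then show ?thesis using path_increment_bound[OF w(3)] that by auto
qed

text \<open>Otherwise finitely supported functions normalised to \<open>1\<close> at \<open>v\<close> and with energies tending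
  to \<open>0\<close> would approximate the constant function \<open>1\<close>.\<close>

lemma transience_bound_at_root:
  obtains C where "C \<ge> 0" "\<And>g. g \<in> C_c \<Longrightarrow> (g v)\<^sup>2 \<le> C * energy g g"
proof -
  have "\<exists>C\<ge>0. \<forall>g\<in>C_c. (g v)\<^sup>2 \<le> C * energy g g"
  proof (rule ccontr)
    assume "\<not> ?thesis"
    then have "\<exists>g\<in>C_c. real (Suc n) * energy g g < (g v)\<^sup>2" for n
      by (metis linorder_not_le of_nat_0_le_iff)
    then obtain g where g: "\<And>n. g n \<in> C_c" "\<And>n. real (Suc n) * energy (g n) (g n) < (g n v)\<^sup>2"
      by metis
    have nz: "g n v \<noteq> 0" for n
    proof
      assume "g n v = 0"
      then have "real (Suc n) * energy (g n) (g n) < 0" using g(2)[of n] by simp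
      then show False using energy_nonneg[of "g n"] by (simp add: mult_less_0_iff)
    qed
    define e where "e n = (\<lambda>x. inverse (g n v) * g n x)" for n
    have e_v: "e n v = 1" for n using nz by (simp add: e_def)
    have e_C_c: "e n \<in> C_c" for n using g(1)[of n] nz by (simp add: e_def C_c_def)
    then have e_D: "e n \<in> D_tilde b c" for n using C_c_subset_D_tilde by blast
    have e_E: "energy (e n) (e n) \<le> 1 / real (Suc n)" for n
    proof -
      have "g n \<in> D_tilde b c" using g(1) C_c_subset_D_tilde by blast
      then have "energy (e n) (e n) = (inverse (g n v))\<^sup>2 * energy (g n) (g n)"
        unfolding e_def by (rule energy_scale)
      also have "\<dots> \<le> (inverse (g n v))\<^sup>2 * ((g n v)\<^sup>2 / real (Suc n))"
        using g(2)[of n]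
        by (intro mult_left_mono) (simp_all add: pos_le_divide_eq mult.commute del: of_nat_Suc)
      also have "\<dots> = 1 / real (Suc n)" using nz[of n] by (simp add: power_inverse)
      finally show ?thesis .
    qed
    have E0: "(\<lambda>n. energy (e n) (e n)) \<longlonglongrightarrow> 0"
      by (rule tendsto_0_if_le_inverse_Suc[OF energy_nonneg e_E])
    have lim: "(\<lambda>n. e n x) \<longlonglongrightarrow> 1" for x
    proof -
      obtain C where C: "C \<ge> 0" "\<And>u. u \<in> D_tilde b c \<Longrightarrow> (u x - u v)\<^sup>2 \<le> C * energy u u"
        using increment_bound by blast
      have "(\<lambda>n. (e n x - 1)\<^sup>2) \<longlonglongrightarrow> 0"
      proof (rule tendsto_sandwich[OF _ _ tendsto_const])
        show "\<forall>\<^sub>F n in sequentially. (e n x - 1)\<^sup>2 \<le> C * energy (e n) (e n)"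
          using C(2)[OF e_D] unfolding e_v by (intro always_eventually allI)
        show "(\<lambda>n. C * energy (e n) (e n)) \<longlonglongrightarrow> 0" using tendsto_mult_left[OF E0, of C] by simp
      qed simp
      then have "(\<lambda>n. sqrt ((e n x - 1)\<^sup>2)) \<longlonglongrightarrow> sqrt 0" by (rule tendsto_real_sqrt)
      then have "(\<lambda>n. e n x - 1) \<longlonglongrightarrow> 0" by (simp add: tendsto_rabs_zero_iff)
      then show ?thesis by (simp add: LIM_zero_iff)
    qed
    have small: "(\<lambda>x. 1) \<in> D_tilde b c \<and> energy (\<lambda>x. 1) (\<lambda>x. 1) \<le> K" if "K > 0" for K
    proof -
      have "\<forall>\<^sub>F n in sequentially. energy (e n) (e n) < K"
        using E0 that by (rule order_tendstoD)
      then have "\<forall>\<^sub>F n in sequentially. e n \<in> D_tilde b c \<and> energy (e n) (e n) \<le> K"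
        by eventually_elim (auto simp: e_D)
      then show ?thesis using energy_Fatou[of e "\<lambda>x. 1", OF lim] by blast
    qed
    have one: "(\<lambda>x. 1) \<in> D_tilde b c" using small[OF zero_less_one] by blast
    have "energy (\<lambda>x. 1) (\<lambda>x. 1) \<le> 0"
      by (rule field_le_epsilon) (use small in simp)
    then have "(gradient (\<lambda>x. 1) i)\<^sup>2 = 0" for i
      using one unfolding D_tilde_iff energy_def
      by (intro nonneg_infsum_le_0D[of _ UNIV]) (auto simp: power2_eq_square)
    then have grad1: "gradient (\<lambda>x. 1) i = 0" for i by simp
    have "energy (\<lambda>x. 1 - e n x) (\<lambda>x. 1 - e n x) = energy (e n) (e n)" for n
      by (simp add: energy_def gradient_diff grad1)
    then have "(\<lambda>x. 1) \<in> D_tilde0 b c v"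
      using e_C_c one E0 lim by (intro D_tilde0I[of e]) auto
    then show False using one_notin_D_tilde0 by blast
  qed
  then show ?thesis using that by blast
qed

lemma transience_bound:
  obtains C where "C \<ge> 0" "\<And>g. g \<in> C_c \<Longrightarrow> (g x)\<^sup>2 \<le> C * energy g g"
proof -
  obtain C where C: "C \<ge> 0" "\<And>g. g \<in> C_c \<Longrightarrow> (g v)\<^sup>2 \<le> C * energy g g"
    using transience_bound_at_root by blast
  obtain B where B: "B \<ge> 0" "\<And>u. u \<in> D_tilde b c \<Longrightarrow> (u x - u v)\<^sup>2 \<le> B * energy u u"
    using increment_bound by blast
  have "(g x)\<^sup>2 \<le> (2 * B + 2 * C) * energy g g" if "g \<in> C_c" for g
  proof -
    have "(g x)\<^sup>2 \<le> 2 * (g x - g v)\<^sup>2 + 2 * (g v)\<^sup>2"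
      using square_add_le[of "g x - g v" "g v"] by simp
    moreover have "(g x - g v)\<^sup>2 \<le> B * energy g g" using B that C_c_subset_D_tilde by blast
    ultimately show ?thesis using C(2)[OF that] unfolding distrib_right mult.assoc by linarith
  qed
  then show ?thesis using that[of "2 * B + 2 * C"] B(1) C(1) by simp
qed

text \<open>The energy-minimal modification of \<open>f\<close> by finitely supported functions is harmonic. A minimising
  sequence is energy-Cauchy by the parallelogram law and converges pointwise by transience.\<close>

lemma harmonic_decomposition:
  assumes f: "f \<in> D_tilde b c" "f \<in> ell_infinity"
  obtains g where "g \<in> C_0" "\<And>x. laplacian b c (\<lambda>x. f x - g x) x = 0"
proof -
  let ?E = "\<lambda>u. energy u u"
  define m where "m = (INF g\<in>C_c. ?E (\<lambda>x. f x - g x))"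
  have zero: "(\<lambda>x. 0) \<in> C_c" by (simp add: C_c_def)
  have bdd: "bdd_below ((\<lambda>g. ?E (\<lambda>x. f x - g x)) ` C_c)"
    by (rule bdd_belowI[of _ 0]) (auto simp: energy_nonneg)
  have m_le: "m \<le> ?E (\<lambda>x. f x - g x)" if "g \<in> C_c" for g
    unfolding m_def using bdd that by (rule cINF_lower)
  have "\<exists>g\<in>C_c. ?E (\<lambda>x. f x - g x) < m + 1 / real (Suc n)" for n
    using cINF_less_iff[OF _ bdd, of "m + 1 / real (Suc n)"] zero by (auto simp: m_def)
  then obtain g where g: "\<And>n. g n \<in> C_c"
    and g_min: "\<And>n. ?E (\<lambda>x. f x - g n x) < m + 1 / real (Suc n)"
    by metis
  have g_D: "g n \<in> D_tilde b c" for n using g C_c_subset_D_tilde by blast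
  have fg_D: "(\<lambda>x. f x - g n x) \<in> D_tilde b c" for n using f g_D by (simp add: D_tilde_diff)
  have cauchy_E: "?E (\<lambda>x. g k x - g n x) \<le> 2 / real (Suc n) + 2 / real (Suc k)" for n k
  proof -
    have half: "(\<lambda>x. 1 / 2 * g n x + 1 / 2 * g k x) \<in> C_c"
      using C_c_add_scale[OF C_c_add_scale[OF zero g, of "1 / 2" n] g, of "1 / 2" k] by simp
    have "?E (\<lambda>x. (f x - g n x) - (f x - g k x)) + ?E (\<lambda>x. (f x - g n x) + (f x - g k x))
        = 2 * ?E (\<lambda>x. f x - g n x) + 2 * ?E (\<lambda>x. f x - g k x)"
      by (rule energy_parallelogram[OF fg_D fg_D])
    moreover have "(\<lambda>x. (f x - g n x) + (f x - g k x))
        = (\<lambda>x. 2 * (f x - (1 / 2 * g n x + 1 / 2 * g k x)))" by (simp add: algebra_simps)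
    moreover have "?E (\<lambda>x. 2 * (f x - (1 / 2 * g n x + 1 / 2 * g k x)))
        = 2\<^sup>2 * ?E (\<lambda>x. f x - (1 / 2 * g n x + 1 / 2 * g k x))"
      using half C_c_subset_D_tilde f by (intro energy_scale D_tilde_diff) auto
    moreover have "m \<le> ?E (\<lambda>x. f x - (1 / 2 * g n x + 1 / 2 * g k x))" using half by (rule m_le)
    moreover have "(\<lambda>x. (f x - g n x) - (f x - g k x)) = (\<lambda>x. g k x - g n x)" by simp
    ultimately show ?thesis using g_min[of n] g_min[of k] by simp
  qed
  have "\<exists>l. (\<lambda>n. g n x) \<longlonglongrightarrow> l" for x
  proof -
    obtain C where C: "C \<ge> 0" "\<And>g. g \<in> C_c \<Longrightarrow> (g x)\<^sup>2 \<le> C * ?E g"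
      using transience_bound by blast
    have "Cauchy (\<lambda>n. g n x)"
    proof (rule metric_CauchyI)
      fix \<epsilon> :: real assume "\<epsilon> > 0"
      have "\<forall>\<^sub>F n in sequentially. 4 * C / real (Suc n) < \<epsilon>\<^sup>2"
        using inverse_Suc_tendsto_0[of "4 * C"] \<open>\<epsilon> > 0\<close> by (intro order_tendstoD(2)) auto
      then obtain N where N: "4 * C / real (Suc N) < \<epsilon>\<^sup>2" by (auto simp: eventually_sequentially)
      have "dist (g n x) (g k x) < \<epsilon>" if "n \<ge> N" "k \<ge> N" for n k
      proof -
        have "2 / real (Suc n) + 2 / real (Suc k) \<le> 2 / real (Suc N) + 2 / real (Suc N)"
          using that by (intro add_mono divide_left_mono) auto
        then have "?E (\<lambda>x. g n x - g k x) \<le> 4 / real (Suc N)" using cauchy_E[of n k] by linarith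
        then have "C * ?E (\<lambda>x. g n x - g k x) \<le> C * (4 / real (Suc N))"
          using C(1) by (rule mult_left_mono)
        then have "(g n x - g k x)\<^sup>2 < \<epsilon>\<^sup>2"
          using C(2)[OF C_c_diff[OF g g], of n k] N by (simp add: mult.commute)
        then have "\<bar>g n x - g k x\<bar>\<^sup>2 < \<epsilon>\<^sup>2" by simp
        then have "\<bar>g n x - g k x\<bar> < \<epsilon>"
          using less_imp_le[OF \<open>\<epsilon> > 0\<close>] by (rule power2_less_imp_less)
        then show ?thesis by (simp only: dist_real_def)
      qed
      then show "\<exists>N. \<forall>n\<ge>N. \<forall>k\<ge>N. dist (g n x) (g k x) < \<epsilon>" by blast
    qed
    then show ?thesis by (simp add: Cauchy_convergent_iff convergent_def)
  qed
  then obtain h where h: "\<And>x. (\<lambda>n. g n x) \<longlonglongrightarrow> h x" by metis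
  have h_D: "(\<lambda>x. h x - g n x) \<in> D_tilde b c \<and> ?E (\<lambda>x. h x - g n x) \<le> 4 / real (Suc n)" for n
  proof -
    have "\<forall>\<^sub>F k in sequentially.
        (\<lambda>x. g k x - g n x) \<in> D_tilde b c \<and> ?E (\<lambda>x. g k x - g n x) \<le> 4 / real (Suc n)"
      using eventually_ge_at_top[of n]
    proof eventually_elim
      case (elim k)
      then have "2 / real (Suc k) \<le> 2 / real (Suc n)" by (intro divide_left_mono) auto
      then have "?E (\<lambda>x. g k x - g n x) \<le> 4 / real (Suc n)" using cauchy_E[of k n] by linarith
      then show ?case using g_D by (simp add: D_tilde_diff)
    qed
    moreover have "(\<lambda>k. g k x - g n x) \<longlonglongrightarrow> h x - g n x" for x
      by (intro tendsto_intros h)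
    ultimately show ?thesis
      using energy_Fatou[of "\<lambda>k x. g k x - g n x" "\<lambda>x. h x - g n x"] by blast
  qed
  have "h \<in> D_tilde b c" using D_tilde_add[OF conjunct1[OF h_D[of 0]] g_D[of 0]] by simp
  moreover have "(\<lambda>n. ?E (\<lambda>x. h x - g n x)) \<longlonglongrightarrow> 0"
    by (rule tendsto_0_if_le_inverse_Suc[OF energy_nonneg conjunct2[OF h_D]])
  ultimately have "h \<in> D_tilde0 b c v" using g h by (intro D_tilde0I)
  then have h_C0: "h \<in> C_0" using D_tilde0_subset_C_0 by blast
  then have h_bdd: "h \<in> ell_infinity" using C_0_subset_ell_infinity by blast
  have "laplacian b c (\<lambda>x. f x - h x) x = 0" for x
  proof -
    let ?I = "indicator {x} :: 'v \<Rightarrow> real"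
    have I: "?I \<in> D_tilde b c" by (rule indicator_in_D_tilde)
    have g_bdd: "g n \<in> ell_infinity" for n using g C_c_subset_ell_infinity by blast
    have bound: "(laplacian b c (\<lambda>x. f x - h x) x)\<^sup>2 \<le> (10 * ?E ?I) / real (Suc n)" for n
    proof -
      let ?p = "energy (\<lambda>x. f x - g n x) ?I" and ?q = "energy (\<lambda>x. h x - g n x) ?I"
      have "?p\<^sup>2 \<le> (?E (\<lambda>x. f x - g n x) - m) * ?E ?I"
      proof (rule square_le_mult_if_quadratic_nonneg)
        fix t
        have "(\<lambda>x. g n x + (- t) * ?I x) \<in> C_c" using g indicator_in_C_c by (rule C_c_add_scale)
        then have "m \<le> ?E (\<lambda>x. f x - (g n x + (- t) * ?I x))" by (rule m_le)
        moreover have "(\<lambda>x. f x - (g n x + (- t) * ?I x)) = (\<lambda>x. (f x - g n x) + t * ?I x)"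
          by (simp add: algebra_simps)
        ultimately show "0 \<le> ?E (\<lambda>x. f x - g n x) - m + 2 * t * ?p + t\<^sup>2 * ?E ?I"
          using energy_add_scale[OF fg_D I, of n t] by simp
      qed (rule energy_nonneg)
      also have "\<dots> \<le> 1 / real (Suc n) * ?E ?I"
        using g_min[of n] by (intro mult_right_mono energy_nonneg) simp
      finally have p: "?p\<^sup>2 \<le> 1 / real (Suc n) * ?E ?I" .
      have "?q\<^sup>2 \<le> ?E (\<lambda>x. h x - g n x) * ?E ?I"
        using h_D I by (intro energy_Cauchy_Schwarz) auto
      also have "\<dots> \<le> 4 / real (Suc n) * ?E ?I"
        using h_D by (intro mult_right_mono energy_nonneg) simp
      finally have q: "?q\<^sup>2 \<le> 4 / real (Suc n) * ?E ?I" .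
      have "?p = laplacian b c f x - laplacian b c (g n) x"
        and "?q = laplacian b c h x - laplacian b c (g n) x"
        using f h_bdd g_bdd by (simp_all add: energy_indicator ell_infinity_diff laplacian_diff)
      then have "laplacian b c (\<lambda>x. f x - h x) x = ?p - ?q"
        using f h_bdd by (simp add: laplacian_diff)
      then have "(laplacian b c (\<lambda>x. f x - h x) x)\<^sup>2 \<le> 2 * ?p\<^sup>2 + 2 * ?q\<^sup>2"
        using square_add_le[of ?p "- ?q"] by simp
      also have "\<dots> \<le> 2 * (1 / real (Suc n) * ?E ?I) + 2 * (4 / real (Suc n) * ?E ?I)"
        using p q by linarith
      also have "\<dots> = (10 * ?E ?I) / real (Suc n)"
        by (simp del: of_nat_Suc flip: add_divide_distrib)
      finally show ?thesis .
    qed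
    have "(\<lambda>n::nat. (laplacian b c (\<lambda>x. f x - h x) x)\<^sup>2) \<longlonglongrightarrow> 0"
      by (rule tendsto_0_if_le_inverse_Suc[OF zero_le_power2 bound])
    then show ?thesis by (simp add: LIMSEQ_const_iff)
  qed
  then show ?thesis using that h_C0 by blast
qed

end

section \<open>The Dirichlet problem on the Royden compactification\<close>

locale royden = transient_graph b c v
  for b :: "'v \<Rightarrow> 'v \<Rightarrow> real" and c v +
  fixes R :: "'r topology" and \<iota> :: "'v \<Rightarrow> 'r"
  assumes royden: "royden_compactification b c R \<iota>"
begin

abbreviation "ext \<equiv> continuous_ext R \<iota>"
abbreviation "boundary \<equiv> royden_boundary R \<iota>"

lemma compact_R: "compact_space R" and Hausdorff_R: "Hausdorff_space R"
  and inj_emb: "inj \<iota>" and open_vertex: "openin R {\<iota> x}"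
  and dense: "R closure_of (range \<iota>) = topspace R"
  and ex1_extension: "f \<in> D_tilde b c \<inter> ell_infinity \<Longrightarrow> \<exists>!g. extends_continuously R \<iota> f g"
  using royden unfolding royden_compactification_def by auto

lemma emb_in_topspace: "\<iota> x \<in> topspace R"
  using openin_subset[OF open_vertex[of x]] by simp

lemma boundary_subset: "boundary \<subseteq> topspace R"
  by (auto simp: royden_boundary_def)

lemma closed_extension:
  assumes "continuous_map R euclideanreal g" and "closed S" and "\<And>x. g (\<iota> x) \<in> S"
    and "p \<in> topspace R"
  shows "g p \<in> S"
proof (rule forall_in_closure_of[of p R "range \<iota>"])
  show "p \<in> R closure_of range \<iota>" using dense assms(4) by simp
  show "closedin R {p \<in> topspace R. g p \<in> S}"
    using assms(1,2) by (auto intro!: closedin_continuous_map_preimage)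
qed (use assms in auto)

lemma extends_continuously_unique:
  assumes "extends_continuously R \<iota> f g" and "extends_continuously R \<iota> f h"
  shows "g = h"
proof (rule extensionalityI[of _ "topspace R"])
  fix p assume p: "p \<in> topspace R"
  have cont: "continuous_map R euclideanreal (\<lambda>p. g p - h p)"
    using assms by (intro continuous_map_diff) (auto simp: extends_continuously_def)
  have "g p - h p \<in> {0}"
    by (rule closed_extension[OF cont _ _ p]) (use assms in \<open>auto simp: extends_continuously_def\<close>)
  then show "g p = h p" by simp
qed (use assms in \<open>auto simp: extends_continuously_def\<close>)

lemma ext_eqI: "extends_continuously R \<iota> f g \<Longrightarrow> ext f = g"
  unfolding continuous_ext_def by (blast intro: extends_continuously_unique the_equality)

lemma ext_eqI':
  assumes "continuous_map R euclideanreal g" and "\<And>x. g (\<iota> x) = f x"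
  shows "extends_continuously R \<iota> f (ext f)" and "p \<in> topspace R \<Longrightarrow> ext f p = g p"
proof -
  have *: "extends_continuously R \<iota> f (restrict g (topspace R))"
    using assms emb_in_topspace
    by (auto simp: extends_continuously_def intro: continuous_map_eq)
  show "extends_continuously R \<iota> f (ext f)" "p \<in> topspace R \<Longrightarrow> ext f p = g p"
    using * unfolding ext_eqI[OF *] by auto
qed

lemma royden_algebra_extends:
  assumes "f \<in> royden_algebra b c"
  shows "extends_continuously R \<iota> f (ext f)"
proof -
  have "\<exists>g\<in>D_tilde b c \<inter> ell_infinity. \<forall>x. \<bar>f x - g x\<bar> \<le> 1 / real (Suc n)" for n
    using assms by (simp add: royden_algebra_iff)
  then obtain g where g: "\<And>n. g n \<in> D_tilde b c \<inter> ell_infinity"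
    and fg: "\<And>n x. \<bar>f x - g n x\<bar> \<le> 1 / real (Suc n)"
    by metis
  obtain G where G: "\<And>n. extends_continuously R \<iota> (g n) (G n)"
    using ex1_extension[OF g] by metis
  have G_cont: "continuous_map R euclideanreal (G n)" and G_emb: "G n (\<iota> x) = g n x" for n x
    using G[of n] by (auto simp: extends_continuously_def)
  have G_diff: "\<bar>G m p - G n p\<bar> \<le> 1 / real (Suc m) + 1 / real (Suc n)"
    if "p \<in> topspace R" for m n p
  proof -
    have cont: "continuous_map R euclideanreal (\<lambda>p. G m p - G n p)"
      by (intro continuous_map_diff G_cont)
    have mem: "g m x - g n x \<in> cball 0 (1 / real (Suc m) + 1 / real (Suc n))" for x
      using fg[of x m] fg[of x n] unfolding mem_cball dist_real_def by linarith
    have "G m p - G n p \<in> cball 0 (1 / real (Suc m) + 1 / real (Suc n))"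
      by (rule closed_extension[OF cont closed_cball _ that]) (unfold G_emb, rule mem)
    then show ?thesis unfolding mem_cball dist_real_def by linarith
  qed
  obtain h where h_cont: "continuous_map R euclideanreal h"
    and h: "\<And>\<epsilon>. 0 < \<epsilon> \<Longrightarrow> \<forall>\<^sub>F n in sequentially. \<forall>p\<in>topspace R. dist (G n p) (h p) < \<epsilon>"
  proof (rule Met_TC.continuous_map_uniformly_Cauchy_limit)
    show "\<forall>\<^sub>F n in sequentially. continuous_map R Met_TC.mtopology (G n)"
      using G_cont by simp
    show "\<exists>N. \<forall>m n p. N \<le> m \<longrightarrow> N \<le> n \<longrightarrow> p \<in> topspace R \<longrightarrow> dist (G m p) (G n p) < \<epsilon>"
      if "\<epsilon> > 0" for \<epsilon>
    proof -
      have "\<forall>\<^sub>F n in sequentially. 2 / real (Suc n) < \<epsilon>"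
        using inverse_Suc_tendsto_0 that by (rule order_tendstoD)
      then obtain N where N: "2 / real (Suc N) < \<epsilon>" by (auto simp: eventually_sequentially)
      have "dist (G m p) (G n p) < \<epsilon>" if "N \<le> m" "N \<le> n" "p \<in> topspace R" for m n p
      proof -
        have "1 / real (Suc m) + 1 / real (Suc n) \<le> 1 / real (Suc N) + 1 / real (Suc N)"
          using that by (intro add_mono divide_left_mono) auto
        then show ?thesis
          using G_diff[OF that(3), of m n] N unfolding dist_real_def by linarith
      qed
      then show ?thesis by blast
    qed
  qed auto
  have "h (\<iota> x) = f x" for x
  proof (rule LIMSEQ_unique)
    show "(\<lambda>n. G n (\<iota> x)) \<longlonglongrightarrow> h (\<iota> x)"
    proof (rule tendstoI)
      fix \<epsilon> :: real assume "\<epsilon> > 0"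
      from h[OF this] show "\<forall>\<^sub>F n in sequentially. dist (G n (\<iota> x)) (h (\<iota> x)) < \<epsilon>"
        by eventually_elim (simp add: emb_in_topspace)
    qed
    have "(\<lambda>n. \<bar>f x - g n x\<bar>) \<longlonglongrightarrow> 0"
      using abs_ge_zero fg by (rule tendsto_0_if_le_inverse_Suc)
    then have "(\<lambda>n. f x - (f x - g n x)) \<longlonglongrightarrow> f x - 0"
      by (intro tendsto_diff tendsto_const) (simp only: tendsto_rabs_zero_iff)
    then show "(\<lambda>n. G n (\<iota> x)) \<longlonglongrightarrow> f x" by (simp add: G_emb)
  qed
  then show ?thesis by (rule ext_eqI'(1)[OF h_cont])
qed

lemma continuous_map_ext: "f \<in> royden_algebra b c \<Longrightarrow> continuous_map R euclideanreal (ext f)"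
  and ext_emb: "f \<in> royden_algebra b c \<Longrightarrow> ext f (\<iota> x) = f x"
  using royden_algebra_extends by (auto simp: extends_continuously_def)

lemma ext_diff:
  assumes "f \<in> royden_algebra b c" "g \<in> royden_algebra b c" "p \<in> topspace R"
  shows "ext (\<lambda>x. f x - g x) p = ext f p - ext g p"
  using assms
  by (intro ext_eqI'(2)[of "\<lambda>p. ext f p - ext g p"] continuous_map_diff)
    (simp_all add: continuous_map_ext ext_emb)

lemma abs_ext_le:
  assumes f: "f \<in> royden_algebra b c" and K: "\<And>x. \<bar>f x\<bar> \<le> K" and p: "p \<in> topspace R"
  shows "\<bar>ext f p\<bar> \<le> K"
proof -
  have "ext f p \<in> cball 0 K"
    using continuous_map_ext[OF f] closed_cball _ p
    by (rule closed_extension) (simp add: ext_emb f K dist_real_def)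
  then show ?thesis by (simp add: dist_real_def)
qed

lemma ext_C_0_boundary:
  assumes f: "f \<in> C_0" and p: "p \<in> boundary"
  shows "ext f p = 0"
proof -
  have fA: "f \<in> royden_algebra b c" using f C_0_subset_royden_algebra by blast
  have pR: "p \<in> topspace R" using p boundary_subset by blast
  have small: "\<bar>ext f p\<bar> \<le> \<epsilon>" if "\<epsilon> > 0" for \<epsilon>
  proof -
    define S where "S = {x. \<bar>f x\<bar> > \<epsilon>}"
    have "finite (\<iota> ` S)" unfolding S_def using C_0_finite_superlevel[OF f that] by simp
    then have "closedin R (\<iota> ` S)"
      using Hausdorff_imp_t1_space[OF Hausdorff_R] emb_in_topspace
      by (auto simp: t1_space_closedin_finite)
    then have "R closure_of (\<iota> ` S) = \<iota> ` S" by (rule closure_of_closedin)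
    moreover have "range \<iota> = \<iota> ` S \<union> \<iota> ` (- S)" by auto
    ultimately have "p \<in> \<iota> ` S \<union> R closure_of (\<iota> ` (- S))"
      using pR dense closure_of_Un by metis
    then have "p \<in> R closure_of (\<iota> ` (- S))" using p by (auto simp: royden_boundary_def)
    then have "ext f p \<in> cball 0 \<epsilon>"
    proof (rule forall_in_closure_of)
      show "closedin R {q \<in> topspace R. ext f q \<in> cball 0 \<epsilon>}"
        by (rule closedin_continuous_map_preimage[OF continuous_map_ext[OF fA]])
          (simp only: closed_closedin[symmetric] closed_cball)
    qed (auto simp: S_def ext_emb fA dist_real_def)
    then show ?thesis by (simp add: dist_real_def)
  qed
  have "\<bar>ext f p\<bar> \<le> 0" by (rule field_le_epsilon) (use small in simp)
  then show ?thesis by simp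
qed

lemma harmonic_boundary_eq: "harmonic_boundary b c v R \<iota> = boundary"
  unfolding harmonic_boundary_def using ext_C_0_boundary D_tilde0_subset_C_0 by blast

lemma boundary_nonempty: "boundary \<noteq> {}"
proof
  assume "boundary = {}"
  then have "topspace R = range \<iota>" using emb_in_topspace by (auto simp: royden_boundary_def)
  then have "discrete_topology (range \<iota>) = R" using open_vertex by (simp add: discrete_topology_unique)
  then have "finite (range \<iota>)" using compact_R compact_space_discrete_topology by metis
  then show False using infinite_vertices inj_emb finite_imageD by blast
qed

lemma maximum_principle_upper:
  assumes g: "continuous_map R euclideanreal g" and f: "\<And>x. g (\<iota> x) = f x"
    and bdd: "f \<in> ell_infinity" and harmonic: "\<And>x. laplacian b c f x = 0"
    and K: "K \<ge> 0" "\<And>p. p \<in> boundary \<Longrightarrow> g p \<le> K"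
  shows "f x \<le> K"
proof (rule ccontr)
  assume "\<not> f x \<le> K"
  have "compact (g ` topspace R)"
    using image_compactin[OF _ g, of "topspace R"] compact_R by (simp add: compact_space_def)
  then obtain p where p: "p \<in> topspace R" and max: "\<And>q. q \<in> topspace R \<Longrightarrow> g q \<le> g p"
    using compact_attains_sup[of "g ` topspace R"] emb_in_topspace by blast
  have M: "g p > K" using max[OF emb_in_topspace[of x]] \<open>\<not> f x \<le> K\<close> f by simp
  then obtain x0 where x0: "p = \<iota> x0" using K(2)[of p] p by (force simp: royden_boundary_def)
  have le: "f y \<le> g p" for y using max[OF emb_in_topspace[of y]] f by simp
  have neighbour: "f y = g p" if "f x = g p" and "b x y > 0" for x y
  proof -
    have "((\<lambda>y. b x y * (f x - f y)) has_sum (- (c x * f x))) UNIV"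
      using laplacian_has_sum[OF bdd, of x] harmonic by simp
    moreover have "c x * f x \<ge> 0" using c_nonneg M K(1) that(1) by simp
    ultimately have "b x y * (f x - f y) = 0"
      using le that(1) b_nonneg
      by (intro nonneg_infsum_le_0D[of "\<lambda>y. b x y * (f x - f y)" UNIV])
        (auto simp: infsumI has_sum_imp_summable)
    then show ?thesis using that by simp
  qed
  have const: "f y = g p" for y
  proof (cases "x0 = y")
    case True
    then show ?thesis using f x0 by simp
  next
    case False
    then obtain n :: nat and w where w: "w 0 = x0" "w n = y" "\<forall>i\<in>{1..n}. b (w (i - 1)) (w i) > 0"
      using connected unfolding graph_connected_def by blast
    have "i \<le> n \<longrightarrow> f (w i) = g p" for i
    proof (induction i)
      case 0
      then show ?case using f x0 w by simp
    next
      case (Suc i)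
      have "b (w i) (w (Suc i)) > 0" if "Suc i \<le> n" using w(3) that by force
      then show ?case using Suc neighbour by auto
    qed
    then show ?thesis using w(2) by blast
  qed
  obtain q where q: "q \<in> boundary" using boundary_nonempty by blast
  have "g q \<in> {g p}"
    by (rule closed_extension[OF g closed_singleton])
      (use q boundary_subset in \<open>auto simp: f const\<close>)
  then show False using K(2)[OF q] M by simp
qed

lemma maximum_principle:
  assumes f: "f \<in> royden_algebra b c" and harmonic: "\<And>x. laplacian b c f x = 0"
    and K: "\<And>p. p \<in> boundary \<Longrightarrow> \<bar>ext f p\<bar> \<le> K"
  shows "\<bar>f x\<bar> \<le> K"
proof -
  have bdd: "f \<in> ell_infinity" using f royden_algebra_subset_ell_infinity by blast
  have zero: "(\<lambda>x. 0) \<in> ell_infinity" by (auto simp: ell_infinity_iff)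
  have neg: "(\<lambda>x. - f x) \<in> ell_infinity" using ell_infinity_diff[OF zero bdd] by simp
  have neg_harmonic: "laplacian b c (\<lambda>x. - f x) x = 0" for x
  proof -
    have "laplacian b c (\<lambda>x. 0) x = 0" by (simp add: laplacian_def)
    then show ?thesis using laplacian_diff[OF zero bdd, of x] harmonic[of x] by simp
  qed
  have "K \<ge> 0" using boundary_nonempty K abs_ge_zero order_trans by blast
  moreover have "ext f p \<le> K" "- ext f p \<le> K" if "p \<in> boundary" for p
    using K[OF that] by simp_all
  ultimately have "f x \<le> K" "- f x \<le> K"
    using maximum_principle_upper[OF continuous_map_ext[OF f] ext_emb[OF f] bdd harmonic]
      maximum_principle_upper[OF continuous_map_minus[OF continuous_map_ext[OF f]] _ neg neg_harmonic]
    by (simp_all add: ext_emb[OF f])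
  then show ?thesis by simp
qed

lemma harmonic_contraction:
  assumes "f \<in> royden_algebra b c" "h \<in> royden_algebra b c" "(\<lambda>x. f x - h x) \<in> C_0"
    and "f' \<in> royden_algebra b c" "h' \<in> royden_algebra b c" "(\<lambda>x. f' x - h' x) \<in> C_0"
    and harmonic: "\<And>x. laplacian b c h x = 0" "\<And>x. laplacian b c h' x = 0"
    and K: "\<And>x. \<bar>f x - f' x\<bar> \<le> K"
  shows "\<bar>h x - h' x\<bar> \<le> K"
proof (rule maximum_principle[of "\<lambda>x. h x - h' x"])
  show "(\<lambda>x. h x - h' x) \<in> royden_algebra b c" using assms by (simp add: royden_algebra_diff)
  show "laplacian b c (\<lambda>x. h x - h' x) x = 0" for x
    using assms by (simp add: laplacian_diff royden_algebra_bounded)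
  fix p assume p: "p \<in> boundary"
  then have pR: "p \<in> topspace R" using boundary_subset by blast
  have "ext f p - ext h p = 0" "ext f' p - ext h' p = 0"
    using ext_C_0_boundary[OF assms(3) p] ext_C_0_boundary[OF assms(6) p] assms pR
    by (simp_all add: ext_diff)
  then have "ext (\<lambda>x. h x - h' x) p = ext (\<lambda>x. f x - f' x) p"
    using assms pR by (simp add: ext_diff)
  then show "\<bar>ext (\<lambda>x. h x - h' x) p\<bar> \<le> K"
    using abs_ext_le[OF royden_algebra_diff[OF assms(1,4)] K pR] by simp
qed

lemma harmonic_part_exists:
  assumes f: "f \<in> royden_algebra b c"
  obtains h where "h \<in> royden_algebra b c" "(\<lambda>x. f x - h x) \<in> C_0" "\<And>x. laplacian b c h x = 0"
proof -
  have DA: "D_tilde b c \<inter> ell_infinity \<subseteq> royden_algebra b c"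
    by (force simp: royden_algebra_iff)
  have "\<exists>u\<in>D_tilde b c \<inter> ell_infinity. \<forall>x. \<bar>f x - u x\<bar> \<le> 1 / real (Suc n)" for n
    using f by (simp add: royden_algebra_iff)
  then obtain u where u: "\<And>n. u n \<in> D_tilde b c \<inter> ell_infinity"
    and fu: "\<And>n x. \<bar>f x - u n x\<bar> \<le> 1 / real (Suc n)"
    by metis
  have "\<exists>g\<in>C_0. \<forall>x. laplacian b c (\<lambda>x. u n x - g x) x = 0" for n
    using harmonic_decomposition[of "u n"] u by blast
  then obtain g where g: "\<And>n. g n \<in> C_0"
    and harmonic: "\<And>n x. laplacian b c (\<lambda>x. u n x - g n x) x = 0"
    by metis
  define k where "k n x = u n x - g n x" for n x
  have uA: "u n \<in> royden_algebra b c" for n using u DA by blast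
  have kA: "k n \<in> royden_algebra b c" for n
    using royden_algebra_diff[OF uA] g C_0_subset_royden_algebra by (auto simp: k_def[abs_def])
  have k0: "(\<lambda>x. u n x - k n x) \<in> C_0" for n using g by (simp add: k_def)
  have k_harmonic: "laplacian b c (k n) x = 0" for n x
    using harmonic[of n x] by (simp add: k_def[abs_def])
  have k_diff: "\<bar>k m x - k n x\<bar> \<le> 1 / real (Suc m) + 1 / real (Suc n)" for m n x
  proof (rule harmonic_contraction[OF uA kA k0 uA kA k0 k_harmonic k_harmonic])
    show "\<bar>u m x - u n x\<bar> \<le> 1 / real (Suc m) + 1 / real (Suc n)" for x
      using fu[of x m] fu[of x n] by linarith
  qed
  have "Cauchy (\<lambda>n. k n x)" for x
  proof (rule metric_CauchyI)
    fix \<epsilon> :: real assume "\<epsilon> > 0"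
    with inverse_Suc_tendsto_0 have "\<forall>\<^sub>F n in sequentially. 2 / real (Suc n) < \<epsilon>"
      by (rule order_tendstoD)
    then obtain N where N: "2 / real (Suc N) < \<epsilon>" by (auto simp: eventually_sequentially)
    have "dist (k m x) (k n x) < \<epsilon>" if "m \<ge> N" "n \<ge> N" for m n
    proof -
      have "1 / real (Suc m) + 1 / real (Suc n) \<le> 1 / real (Suc N) + 1 / real (Suc N)"
        using that by (intro add_mono divide_left_mono) auto
      then show ?thesis using k_diff[of m x n] N unfolding dist_real_def by linarith
    qed
    then show "\<exists>N. \<forall>m\<ge>N. \<forall>n\<ge>N. dist (k m x) (k n x) < \<epsilon>" by blast
  qed
  then have "\<exists>l. (\<lambda>n. k n x) \<longlonglongrightarrow> l" for x
    by (simp add: Cauchy_convergent_iff convergent_def)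
  then obtain h where h: "\<And>x. (\<lambda>n. k n x) \<longlonglongrightarrow> h x" by metis
  have h_k: "\<bar>h x - k n x\<bar> \<le> 1 / real (Suc n)" for x n
  proof (rule LIMSEQ_le[OF _ _ exI[of _ 0]])
    show "(\<lambda>m. \<bar>k m x - k n x\<bar>) \<longlonglongrightarrow> \<bar>h x - k n x\<bar>" by (intro tendsto_intros h)
    show "(\<lambda>m. 1 / real (Suc m) + 1 / real (Suc n)) \<longlonglongrightarrow> 1 / real (Suc n)"
      using tendsto_add[OF inverse_Suc_tendsto_0[of 1] tendsto_const[of "1 / real (Suc n)"]] by simp
  qed (use k_diff in blast)
  have fh: "(\<lambda>x. f x - h x) \<in> C_0"
  proof (rule C_0_uniform_limit)
    fix \<epsilon> :: real assume "\<epsilon> > 0"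
    with inverse_Suc_tendsto_0 have "\<forall>\<^sub>F n in sequentially. 2 / real (Suc n) < \<epsilon>"
      by (rule order_tendstoD)
    then obtain n where n: "2 / real (Suc n) < \<epsilon>" by (auto simp: eventually_sequentially)
    have "\<bar>(f x - h x) - g n x\<bar> \<le> \<epsilon>" for x
    proof -
      have "\<bar>(f x - h x) - g n x\<bar> \<le> 1 / real (Suc n) + 1 / real (Suc n)"
        using fu[of x n] h_k[of x n] unfolding k_def by linarith
      then show ?thesis using n by linarith
    qed
    then show "\<exists>g\<in>C_0. \<forall>x. \<bar>(f x - h x) - g x\<bar> \<le> \<epsilon>" using g by blast
  qed
  then have hA: "h \<in> royden_algebra b c"
    using royden_algebra_diff[OF f, of "\<lambda>x. f x - h x"] C_0_subset_royden_algebra by auto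
  have "laplacian b c h x = 0" for x
  proof -
    let ?D = "2 * infsum (b x) UNIV + c x"
    have bound: "\<bar>laplacian b c h x\<bar> \<le> ?D / real (Suc n)" for n
    proof -
      have "laplacian b c (\<lambda>x. h x - k n x) x = laplacian b c h x"
        using hA kA k_harmonic by (simp add: laplacian_diff royden_algebra_bounded)
      then show ?thesis using abs_laplacian_le[of "\<lambda>x. h x - k n x", OF h_k, of x] by simp
    qed
    have "(\<lambda>n::nat. \<bar>laplacian b c h x\<bar>) \<longlonglongrightarrow> 0"
      by (rule tendsto_0_if_le_inverse_Suc[OF abs_ge_zero bound])
    then show ?thesis by (simp add: LIMSEQ_const_iff)
  qed
  then show ?thesis using that hA fh by blast
qed

lemma solves_iff:
  assumes "f \<in> royden_algebra b c"
  shows "solves_dirichlet_problem b c v R \<iota> \<phi> f \<longleftrightarrow>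
    (\<forall>x. laplacian b c f x = 0) \<and> restrict (ext f) boundary = \<phi>"
  using assms royden_algebra_subset_ell_infinity ell_infinity_subset_F_tilde
  unfolding solves_dirichlet_problem_def harmonic_boundary_eq by blast

lemma solutions_dist:
  assumes f: "f \<in> royden_algebra b c" "solves_dirichlet_problem b c v R \<iota> \<phi> f"
    and g: "g \<in> royden_algebra b c" "solves_dirichlet_problem b c v R \<iota> \<psi> g"
  shows "sup_norm UNIV (\<lambda>x. f x - g x) = sup_norm boundary (\<lambda>p. \<phi> p - \<psi> p)"
proof -
  let ?d = "\<lambda>x. f x - g x"
  have d: "?d \<in> royden_algebra b c" using f g by (simp add: royden_algebra_diff)
  have harmonic: "laplacian b c ?d x = 0" for x
    using f g by (simp add: laplacian_diff royden_algebra_bounded solves_iff)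
  have ext_d: "ext ?d p = \<phi> p - \<psi> p" if "p \<in> boundary" for p
    using f g that boundary_subset by (auto simp: solves_iff ext_diff)
  have bdd: "bounded (range ?d)"
    using d royden_algebra_subset_ell_infinity by (auto simp: ell_infinity_def)
  have le: "\<bar>\<phi> p - \<psi> p\<bar> \<le> sup_norm UNIV ?d" if "p \<in> boundary" for p
    using abs_ext_le[OF d abs_le_sup_norm[OF bdd]] that boundary_subset ext_d by force
  have bdd': "bounded ((\<lambda>p. \<phi> p - \<psi> p) ` boundary)"
    using le by (auto simp: bounded_iff)
  have le': "\<bar>?d x\<bar> \<le> sup_norm boundary (\<lambda>p. \<phi> p - \<psi> p)" for x
    using d harmonic by (rule maximum_principle) (simp add: ext_d abs_le_sup_norm[OF bdd'])
  have "sup_norm UNIV ?d \<ge> 0" "sup_norm boundary (\<lambda>p. \<phi> p - \<psi> p) \<ge> 0"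
    using abs_le_sup_norm[OF bdd, of v] le'[of v] by auto
  then show ?thesis using le le' by (intro antisym sup_norm_le)
qed

lemma ex1_solution:
  assumes "\<phi> \<in> C_0_harmonic_boundary b c v R \<iota>"
  shows "\<exists>!f. f \<in> royden_algebra b c \<and> solves_dirichlet_problem b c v R \<iota> \<phi> f"
proof (rule ex_ex1I)
  obtain f where f: "f \<in> royden_algebra b c" "\<phi> = restrict (ext f) boundary"
    using assms by (auto simp: C_0_harmonic_boundary_def harmonic_boundary_eq)
  obtain h where h: "h \<in> royden_algebra b c" "(\<lambda>x. f x - h x) \<in> C_0" "\<And>x. laplacian b c h x = 0"
    using harmonic_part_exists[OF f(1)] by blast
  have "ext h p = ext f p" if "p \<in> boundary" for p
    using ext_C_0_boundary[OF h(2) that] f h that boundary_subset by (auto simp: ext_diff)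
  then have "restrict (ext h) boundary = \<phi>" using f(2) by (auto simp: restrict_def)
  then show "\<exists>f. f \<in> royden_algebra b c \<and> solves_dirichlet_problem b c v R \<iota> \<phi> f"
    using h by (auto simp: solves_iff)
next
  fix f g
  assume f: "f \<in> royden_algebra b c \<and> solves_dirichlet_problem b c v R \<iota> \<phi> f"
    and g: "g \<in> royden_algebra b c \<and> solves_dirichlet_problem b c v R \<iota> \<phi> g"
  have bdd: "bounded (range (\<lambda>x. f x - g x))"
    using f g ell_infinity_diff[of f g] royden_algebra_bounded by (auto simp: ell_infinity_def)
  have "sup_norm UNIV (\<lambda>x. f x - g x) = sup_norm boundary (\<lambda>p. \<phi> p - \<phi> p)"
    using f g by (blast intro: solutions_dist)
  also have "\<dots> \<le> 0" by (rule sup_norm_le) simp_all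
  finally have "\<bar>f x - g x\<bar> \<le> 0" for x
    using abs_le_sup_norm[OF bdd UNIV_I, of x] by linarith
  then show "f = g" by (simp add: fun_eq_iff)
qed

end

theorem theorem4p9:
  fixes b :: "'v \<Rightarrow> 'v \<Rightarrow> real" and c :: "'v \<Rightarrow> real" and v :: 'v
    and R :: "'r topology" and \<iota> :: "'v \<Rightarrow> 'r"
  assumes "countable (UNIV :: 'v set)" and "infinite (UNIV :: 'v set)"
    and "weighted_graph b c" and "graph_connected b" and "uniformly_transient b c v"
    and "royden_compactification b c R \<iota>"
  shows "(\<forall>\<phi> \<in> C_0_harmonic_boundary b c v R \<iota>.
            \<exists>!f. f \<in> royden_algebra b c \<and> solves_dirichlet_problem b c v R \<iota> \<phi> f) \<and>
         (\<forall>\<phi> \<in> C_0_harmonic_boundary b c v R \<iota>. \<forall>\<psi> \<in> C_0_harmonic_boundary b c v R \<iota>.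
            sup_norm UNIV
              (\<lambda>x. dirichlet_solution b c v R \<iota> \<phi> x - dirichlet_solution b c v R \<iota> \<psi> x)
            = sup_norm (harmonic_boundary b c v R \<iota>) (\<lambda>p. \<phi> p - \<psi> p))"
proof -
  interpret royden b c v R \<iota>
    using assms by unfold_locales
  have "dirichlet_solution b c v R \<iota> \<phi> \<in> royden_algebra b c \<and>
      solves_dirichlet_problem b c v R \<iota> \<phi> (dirichlet_solution b c v R \<iota> \<phi>)"
    if "\<phi> \<in> C_0_harmonic_boundary b c v R \<iota>" for \<phi>
    unfolding dirichlet_solution_def using ex1_solution[OF that] by (rule theI')
  then show ?thesis
    using ex1_solution by (auto simp: harmonic_boundary_eq intro!: solutions_dist)
qed

end
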